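(* Let $k$ be a field of characteristic $p>0$, let $n,r$ be integers with $2\le r<n$, and let $k[\boldsymbol x]=k[x_1,\ldots,x_n]$ be the polynomial ring. Let $\epsilon\in\mathrm{Aut}_k k[\boldsymbol x]$ be given by $\epsilon(x_1)=x_1+1$ and $\epsilon(x_i)=x_i$ for $i\ge2$. Set $f_1:=x_1+x_n^{-1}x_r^p$, $$f_i:=x_i+x_n^{-1}(x_2^p+x_3^p+\cdots+x_{i-1}^p)+x_n^{p-1}(f_1^p-f_1)\quad\text{for } i=2,\ldots,r,$$ and $f_i:=x_i$ for $i=r+1,\ldots,n-1$. Then $k[x_n^{\pm1}][f_1,\ldots,f_{n-1}]=k[x_n^{\pm1}][x_1,\ldots,x_{n-1}]$; let $\widetilde E$ be the $\mathbf{G}_a$-action on this ring over $k[x_n^{\pm1}]$ with $\widetilde E(f_1)=f_1+T$ and $\widetilde E(f_i)=f_i$ for $i=2,\ldots,n-1$. (i) $\widetilde E$ restricts to a $\mathbf{G}_a$-action $E$ on $k[\boldsymbol x]$ with $E_1=\epsilon$. (ii) $k[\boldsymbol x]^E=k[x_nf_2,\ldots,x_nf_r,x_{r+1},\ldots,x_n]$, and $E$ has rank $r$.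
   Context: A $\mathbf{G}_a$-action on a ring $B$ is a ring homomorphism $E:B\to B[T]$ ($T$ a variable) such that: (A1) $E$ followed by $T\mapsto 0$ is the identity of $B$; (A2) if $E(b)=\sum_i b_iT^i$, then $\sum_i E(b_i)|_{T=T_1}\,T_2^i=\sum_i b_i(T_1+T_2)^i$ in $B[T_1,T_2]$, for all $b\in B$. Its invariant ring is $B^E=\{b\in B\mid E(b)=b\}$. For $a\in B^E$, $E_a:B\to B$ is $E$ followed by $T\mapsto a$. $E$ is over a subring $R$ if $R\subset B^E$. $E$ restricts to a subring $B'\subset B$ if $E(B')\subset B'[T]$. For a $k$-subalgebra $A$ of $k[\boldsymbol x]$, $\gamma(A)$ is the maximum of the integers $0\le N\le n$ such that $\phi(k[x_1,\ldots,x_N])\subset A$ for some $\phi\in\mathrm{Aut}_k k[\boldsymbol x]$. The rank of a $\mathbf{G}_a$-action $E$ on $k[\boldsymbol x]$ is $n-\gamma(k[\boldsymbol x]^E)$. *)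

theory Defs
  imports
    "HOL-Library.Poly_Mapping"
    "HOL-Computational_Algebra.Computational_Algebra"
begin

section \<open>Subrings, adjunction, \<open>G\<^sub>a\<close>-actions\<close>

text \<open>Rings are carrier sets inside a commutative ring type; maps between them are
  functions of the ambient types, of which only the values on the carrier matter.\<close>

definition is_subring :: "'a::comm_ring_1 set \<Rightarrow> bool" where
  "is_subring B \<longleftrightarrow> 0 \<in> B \<and> 1 \<in> B \<and>
     (\<forall>x\<in>B. \<forall>y\<in>B. x + y \<in> B \<and> x * y \<in> B) \<and> (\<forall>x\<in>B. - x \<in> B)"

text \<open>\<open>adjoin R S\<close> is \<open>R[S]\<close>.\<close>

definition adjoin :: "'a::comm_ring_1 set \<Rightarrow> 'a set \<Rightarrow> 'a set" where
  "adjoin R S = is_subring hull (R \<union> S)"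

definition is_ring_hom_on :: "'a::comm_ring_1 set \<Rightarrow> ('a \<Rightarrow> 'b::comm_ring_1) \<Rightarrow> bool" where
  "is_ring_hom_on B h \<longleftrightarrow> h 1 = 1 \<and>
     (\<forall>x\<in>B. \<forall>y\<in>B. h (x + y) = h x + h y \<and> h (x * y) = h x * h y)"

definition restricts_to :: "('a::comm_ring_1 \<Rightarrow> 'a poly) \<Rightarrow> 'a set \<Rightarrow> bool" where
  "restricts_to E B \<longleftrightarrow> (\<forall>b\<in>B. \<forall>i. coeff (E b) i \<in> B)"

text \<open>In the last conjunct, \<open>B[T\<^sub>1,T\<^sub>2]\<close> is read as \<open>B[T\<^sub>1][T\<^sub>2]\<close>: the inner polynomial
  variable is \<open>T\<^sub>1 = [:[:0, 1:]:]\<close> and the outer one is \<open>T\<^sub>2 = [:0, 1:]\<close>.\<close>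

definition Ga_action :: "'a::comm_ring_1 set \<Rightarrow> ('a \<Rightarrow> 'a poly) \<Rightarrow> bool" where
  "Ga_action B E \<longleftrightarrow> is_subring B \<and> restricts_to E B \<and> is_ring_hom_on B E \<and>
     (\<forall>b\<in>B. poly (E b) 0 = b) \<and>
     (\<forall>b\<in>B. (\<Sum>i\<le>degree (E b). [:E (coeff (E b) i):] * [:0, 1:] ^ i) =
             (\<Sum>i\<le>degree (E b). [:[:coeff (E b) i:]:] * ([:[:0, 1:]:] + [:0, 1:]) ^ i))"

definition invariants :: "'a::comm_ring_1 set \<Rightarrow> ('a \<Rightarrow> 'a poly) \<Rightarrow> 'a set" where
  "invariants B E = {b \<in> B. E b = [:b:]}"

definition action_at :: "('a::comm_ring_1 \<Rightarrow> 'a poly) \<Rightarrow> 'a \<Rightarrow> 'a \<Rightarrow> 'a" where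
  "action_at E a b = poly (E b) a"

section \<open>Polynomial and Laurent polynomial rings\<close>

text \<open>All rings of the statement live in the ring of Laurent polynomials over \<open>k\<close> in
  indeterminates \<open>x\<^sub>i\<close> (\<open>i :: nat\<close>): the group algebra of the finitely supported exponent
  vectors \<open>nat \<Rightarrow>\<^sub>0 int\<close>.  The monomials are linearly independent over \<open>k\<close>, so the
  subalgebra generated by \<open>x\<^sub>1, \<dots>, x\<^sub>n\<close> is the polynomial ring in \<open>n\<close> variables.\<close>

type_synonym 'k laurent = "(nat \<Rightarrow>\<^sub>0 int) \<Rightarrow>\<^sub>0 'k"

definition X :: "nat \<Rightarrow> 'k::field laurent" where
  "X i = Poly_Mapping.single (Poly_Mapping.single i 1) 1"

definition Xinv :: "nat \<Rightarrow> 'k::field laurent" where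
  "Xinv i = Poly_Mapping.single (Poly_Mapping.single i (- 1)) 1"

lemma X_mult_Xinv: "X i * Xinv i = (1 :: 'k::field laurent)"
  by (simp add: X_def Xinv_def mult_single flip: single_add)

definition const :: "'k::field \<Rightarrow> 'k laurent" where
  "const c = Poly_Mapping.single 0 c"

definition kalg :: "'k::field laurent set \<Rightarrow> 'k laurent set" where
  "kalg S = adjoin (range const) S"

definition polyring :: "nat \<Rightarrow> 'k::field laurent set" where
  "polyring n = kalg (X ` {1..n})"

definition kaut :: "nat \<Rightarrow> ('k::field laurent \<Rightarrow> 'k laurent) set" where
  "kaut n = {\<phi>. bij_betw \<phi> (polyring n) (polyring n) \<and> is_ring_hom_on (polyring n) \<phi> \<and>
                (\<forall>c. \<phi> (const c) = const c)}"

definition gamma :: "nat \<Rightarrow> 'k::field laurent set \<Rightarrow> nat" where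
  "gamma n A = Max {N. N \<le> n \<and> (\<exists>\<phi>\<in>kaut n. \<phi> ` polyring N \<subseteq> A)}"

definition Ga_rank :: "nat \<Rightarrow> ('k::field laurent \<Rightarrow> 'k laurent poly) \<Rightarrow> nat" where
  "Ga_rank n E = n - gamma n (invariants (polyring n) E)"

section \<open>The elements \<open>f\<^sub>i\<close> and the action\<close>

text \<open>\<open>laurent_base n\<close> is \<open>k[x\<^sub>n\<^sup>\<plusminus>\<^sup>1]\<close>, and \<open>laurent_ring n\<close> is
  \<open>k[x\<^sub>n\<^sup>\<plusminus>\<^sup>1][x\<^sub>1, \<dots>, x\<^bsub>n-1\<^esub>]\<close>.\<close>

definition laurent_base :: "nat \<Rightarrow> 'k::field laurent set" where
  "laurent_base n = kalg {X n, Xinv n}"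

definition laurent_ring :: "nat \<Rightarrow> 'k::field laurent set" where
  "laurent_ring n = adjoin (laurent_base n) (X ` {1..n - 1})"

definition f1 :: "nat \<Rightarrow> nat \<Rightarrow> nat \<Rightarrow> 'k::field laurent" where
  "f1 p n r = X 1 + Xinv n * X r ^ p"

definition f :: "nat \<Rightarrow> nat \<Rightarrow> nat \<Rightarrow> nat \<Rightarrow> 'k::field laurent" where
  "f p n r i =
     (if i = 1 then f1 p n r
      else if i \<le> r then
        X i + Xinv n * (\<Sum>j\<in>{2..<i}. X j ^ p) + X n ^ (p - 1) * (f1 p n r ^ p - f1 p n r)
      else X i)"

definition is_E_tilde ::
  "nat \<Rightarrow> nat \<Rightarrow> nat \<Rightarrow> ('k::field laurent \<Rightarrow> 'k laurent poly) \<Rightarrow> bool" where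
  "is_E_tilde p n r E \<longleftrightarrow>
     Ga_action (laurent_ring n) E \<and>
     laurent_base n \<subseteq> invariants (laurent_ring n) E \<and>
     E (f p n r 1) = [:f p n r 1:] + [:0, 1:] \<and>
     (\<forall>i\<in>{2..n - 1}. E (f p n r i) = [:f p n r i:])"

end

theory Submission
  imports Defs
begin

text \<open>Write \<open>z = x\<^sub>n\<close>. Solving the equations \<open>E f\<^sub>1 = f\<^sub>1 + T\<close>, \<open>E f\<^sub>i = f\<^sub>i\<close> with the help of the
  Frobenius map shows inductively that \<open>E x\<^sub>i - x\<^sub>i\<close> is a multiple of \<open>z\<^bsup>p-1\<^esup>\<close> for \<open>2 \<le> i \<le> r\<close>,
  and that it vanishes at \<open>T = 1\<close> because \<open>T\<^sup>p - T\<close> does; the negative powers of \<open>z\<close> cancel since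
  \<open>p (p - 1) - 1 \<ge> p - 1\<close>.

  As \<open>f\<^sub>1\<close> is a slice, an invariant \<open>b\<close> equals \<open>E b\<close> at \<open>T = - f\<^sub>1\<close>, hence lies in
  \<open>k[z\<^sup>\<plusminus>\<^sup>1, f\<^sub>2, \<dots>, f\<^bsub>n-1\<^esub>]\<close>, and a power of \<open>z\<close> moves it into
  \<open>A = k[z f\<^sub>2, \<dots>, z f\<^sub>r, x\<^bsub>r+1\<^esub>, \<dots>, x\<^sub>n]\<close>. That power can be cancelled within \<open>A\<close>: modulo \<open>z\<close> the
  element \<open>z f\<^sub>i\<close> is \<open>x\<^sub>2\<^sup>p + \<dots> + x\<^bsub>i-1\<^esub>\<^sup>p + x\<^sub>r\<^bsup>p*p\<^esup>\<close>, and these are algebraically independent.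

  For the rank, each \<open>z f\<^sub>i\<close> has zero linear part at the origin, so the linear parts of the elements
  of \<open>A\<close> are combinations of \<open>x\<^bsub>r+1\<^esub>, \<dots>, x\<^sub>n\<close>, whereas the linear parts of the images of
  \<open>x\<^sub>1, \<dots>, x\<^sub>n\<close> under an automorphism are linearly independent.\<close>

section \<open>Subrings and ring homomorphisms on carriers\<close>

named_theorems subring_closed

lemma subring_zero [subring_closed]: "is_subring B \<Longrightarrow> 0 \<in> B"
  and subring_one [subring_closed]: "is_subring B \<Longrightarrow> 1 \<in> B"
  and subring_add [subring_closed]: "is_subring B \<Longrightarrow> x \<in> B \<Longrightarrow> y \<in> B \<Longrightarrow> x + y \<in> B"
  and subring_mult [subring_closed]: "is_subring B \<Longrightarrow> x \<in> B \<Longrightarrow> y \<in> B \<Longrightarrow> x * y \<in> B"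
  and subring_uminus [subring_closed]: "is_subring B \<Longrightarrow> x \<in> B \<Longrightarrow> - x \<in> B"
  by (auto simp: is_subring_def)

lemma subring_diff [subring_closed]: "is_subring B \<Longrightarrow> x \<in> B \<Longrightarrow> y \<in> B \<Longrightarrow> x - y \<in> B"
  using subring_add[of B x "- y"] by (simp add: subring_uminus)

lemma subring_power [subring_closed]: "is_subring B \<Longrightarrow> x \<in> B \<Longrightarrow> x ^ k \<in> B"
  by (induction k) (auto intro: subring_closed)

lemma subring_sum [subring_closed]:
  "is_subring B \<Longrightarrow> (\<And>i. i \<in> I \<Longrightarrow> g i \<in> B) \<Longrightarrow> sum g I \<in> B"
  by (induction I rule: infinite_finite_induct) (auto intro: subring_closed)

lemma is_subringI:
  assumes "0 \<in> B" "1 \<in> B" "\<And>x y. x \<in> B \<Longrightarrow> y \<in> B \<Longrightarrow> x + y \<in> B"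
    "\<And>x y. x \<in> B \<Longrightarrow> y \<in> B \<Longrightarrow> x * y \<in> B" "\<And>x. x \<in> B \<Longrightarrow> - x \<in> B"
  shows "is_subring B"
  using assms by (auto simp: is_subring_def)

lemma is_subring_adjoin [simp]: "is_subring (adjoin R S)"
  unfolding adjoin_def by (rule hull_in) (auto simp: is_subring_def)

lemma adjoin_base: "x \<in> R \<Longrightarrow> x \<in> adjoin R S"
  and adjoin_generator: "x \<in> S \<Longrightarrow> x \<in> adjoin R S"
  by (auto simp: adjoin_def intro: hull_inc)

lemma adjoin_subset: "is_subring B \<Longrightarrow> R \<subseteq> B \<Longrightarrow> S \<subseteq> B \<Longrightarrow> adjoin R S \<subseteq> B"
  unfolding adjoin_def by (rule hull_minimal) auto

lemma hom_one: "is_ring_hom_on B h \<Longrightarrow> h 1 = 1"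
  and hom_add: "is_ring_hom_on B h \<Longrightarrow> x \<in> B \<Longrightarrow> y \<in> B \<Longrightarrow> h (x + y) = h x + h y"
  and hom_mult: "is_ring_hom_on B h \<Longrightarrow> x \<in> B \<Longrightarrow> y \<in> B \<Longrightarrow> h (x * y) = h x * h y"
  by (auto simp: is_ring_hom_on_def)

lemma hom_subset: "is_ring_hom_on B h \<Longrightarrow> C \<subseteq> B \<Longrightarrow> is_ring_hom_on C h"
  unfolding is_ring_hom_on_def by blast

lemma hom_comp:
  "is_ring_hom_on B h \<Longrightarrow> is_ring_hom_on C g \<Longrightarrow> h ` B \<subseteq> C \<Longrightarrow> is_ring_hom_on B (\<lambda>x. g (h x))"
  by (auto simp: is_ring_hom_on_def image_subset_iff)

lemma hom_id: "is_ring_hom_on B (\<lambda>x. x)"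
  by (auto simp: is_ring_hom_on_def)

context
  fixes B :: "'a::comm_ring_1 set" and h :: "'a \<Rightarrow> 'b::comm_ring_1"
  assumes B: "is_subring B" and h: "is_ring_hom_on B h"
begin

lemma hom_zero: "h 0 = 0"
  using hom_add[OF h, of 0 0] subring_zero[OF B] by simp

lemma hom_uminus: "x \<in> B \<Longrightarrow> h (- x) = - h x"
  using hom_add[OF h, of x "- x"] hom_zero subring_uminus[OF B, of x]
  by (simp add: eq_neg_iff_add_eq_0 add.commute)

lemma hom_diff: "x \<in> B \<Longrightarrow> y \<in> B \<Longrightarrow> h (x - y) = h x - h y"
  using hom_add[OF h, of x "- y"] subring_uminus[OF B, of y] by (simp add: hom_uminus)

lemma hom_power: "x \<in> B \<Longrightarrow> h (x ^ k) = h x ^ k"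
  by (induction k) (simp_all add: hom_one[OF h] hom_mult[OF h] subring_power[OF B])

lemma hom_sum: "(\<And>i. i \<in> I \<Longrightarrow> g i \<in> B) \<Longrightarrow> h (sum g I) = (\<Sum>i\<in>I. h (g i))"
  by (induction I rule: infinite_finite_induct)
     (simp_all add: hom_zero hom_add[OF h] subring_sum[OF B])

text \<open>Pulling a subring back along \<open>h\<close> turns a claim about the image of a
  generated ring into a claim about the images of its generators.\<close>

lemma subring_vimage: "is_subring C \<Longrightarrow> is_subring {x \<in> B. h x \<in> C}"
  by (rule is_subringI)
     (auto simp: hom_zero hom_one[OF h] hom_add[OF h] hom_mult[OF h] hom_uminus
       intro: subring_closed B)

lemma hom_image_adjoin:
  assumes "is_subring C" "R \<subseteq> B" "S \<subseteq> B" "h ` R \<subseteq> C" "h ` S \<subseteq> C"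
  shows "h ` adjoin R S \<subseteq> C"
  using adjoin_subset[OF subring_vimage[OF assms(1)], of R S] assms(2-) by blast

end

text \<open>The equalizer of two homomorphisms is a subring. This reduces the action axioms, the
  uniqueness of the action and the identity E_1 = \<epsilon> to checks on generators.\<close>

lemma hom_eq_on_adjoin:
  assumes B: "is_subring B" and h: "is_ring_hom_on B h" and g: "is_ring_hom_on B g"
    and "R \<subseteq> B" "S \<subseteq> B" "\<And>x. x \<in> R \<Longrightarrow> h x = g x" "\<And>x. x \<in> S \<Longrightarrow> h x = g x"
    and "x \<in> adjoin R S"
  shows "h x = g x"
proof -
  have "is_subring {x \<in> B. h x = g x}"
    by (rule is_subringI)
       (auto simp: hom_zero[OF B h] hom_zero[OF B g] hom_one[OF h] hom_one[OF g] hom_add[OF h]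
         hom_add[OF g] hom_mult[OF h] hom_mult[OF g] hom_uminus[OF B h] hom_uminus[OF B g]
         intro: subring_closed B)
  from adjoin_subset[OF this, of R S] assms(4-) show ?thesis by blast
qed

lemma is_subring_image:
  assumes B: "is_subring B" and h: "is_ring_hom_on B h"
  shows "is_subring (h ` B)"
proof (rule is_subringI)
  show "0 \<in> h ` B" "1 \<in> h ` B"
    using hom_zero[OF B h] hom_one[OF h] subring_zero[OF B] subring_one[OF B] by force+
next
  fix x y assume "x \<in> h ` B" "y \<in> h ` B"
  then obtain u v where "u \<in> B" "v \<in> B" "x = h u" "y = h v" by blast
  then show "x + y \<in> h ` B" "x * y \<in> h ` B"
    using subring_add[OF B, of u v] subring_mult[OF B, of u v]
    by (simp_all flip: hom_add[OF h] hom_mult[OF h])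
next
  fix x assume "x \<in> h ` B"
  then obtain u where "u \<in> B" "x = h u" by blast
  then show "- x \<in> h ` B"
    using subring_uminus[OF B, of u] by (simp flip: hom_uminus[OF B h])
qed

lemma is_subring_poly_coeffs:
  assumes "is_subring B"
  shows "is_subring {q. \<forall>i. coeff q i \<in> B}"
  by (rule is_subringI)
     (auto simp: coeff_mult coeff_pCons one_pCons split: nat.split intro!: assms subring_closed)

lemma is_subring_invariants:
  assumes B: "is_subring B" and E: "is_ring_hom_on B E"
  shows "is_subring (invariants B E)"
  unfolding invariants_def
  by (rule is_subringI)
     (auto simp: hom_zero[OF B E] hom_one[OF E] hom_add[OF E] hom_mult[OF E] hom_uminus[OF B E]
       one_pCons intro: subring_closed B)

section \<open>Laurent polynomials and substitution\<close>

lemma const_0 [simp]: "const 0 = 0"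
  and const_1 [simp]: "const 1 = 1"
  and const_add: "const (c + d) = const c + const d"
  and const_mult: "const (c * d) = const c * const d"
  by (simp_all add: const_def single_add mult_single)

lemma Xinv_mult_X: "Xinv i * X i = (1 :: 'k::field laurent)"
  using X_mult_Xinv[of i] by (simp add: mult.commute)

lemma is_subring_kalg [simp]: "is_subring (kalg S)"
  by (simp add: kalg_def)

lemma const_in_kalg [simp]: "const c \<in> kalg S"
  by (simp add: kalg_def adjoin_base)

lemma kalg_generator: "x \<in> S \<Longrightarrow> x \<in> kalg S"
  by (simp add: kalg_def adjoin_generator)

lemma kalg_subset: "is_subring B \<Longrightarrow> range const \<subseteq> B \<Longrightarrow> S \<subseteq> B \<Longrightarrow> kalg S \<subseteq> B"
  by (simp add: kalg_def adjoin_subset)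

lemma X_in_polyring: "1 \<le> i \<Longrightarrow> i \<le> n \<Longrightarrow> X i \<in> polyring n"
  by (auto simp: polyring_def intro: kalg_generator)

lemma is_subring_polyring [simp]: "is_subring (polyring n)"
  by (simp add: polyring_def)

lemma const_in_polyring [simp]: "const c \<in> polyring n"
  by (simp add: polyring_def)

text \<open>The common domain of the substitutions: \<open>V = {n}\<close> covers
  \<open>laurent_ring n\<close>, and \<open>V = {}\<close> covers every
  \<open>polyring n\<close>.\<close>

definition laurent_in :: "nat set \<Rightarrow> 'k::field laurent set" where
  "laurent_in V = {P. \<forall>m\<in>Poly_Mapping.keys P. \<forall>i. i \<notin> V \<longrightarrow> 0 \<le> Poly_Mapping.lookup m i}"

lemma is_subring_laurent_in [simp]: "is_subring (laurent_in V :: 'k::field laurent set)"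
proof (rule is_subringI)
  fix x y :: "'k laurent" assume "x \<in> laurent_in V" "y \<in> laurent_in V"
  then show "x + y \<in> laurent_in V" "x * y \<in> laurent_in V"
    using Poly_Mapping.keys_add[of x y] keys_mult[of x y]
    by (force simp: laurent_in_def lookup_add)+
qed (auto simp: laurent_in_def in_keys_iff)

lemma const_in_laurent_in [simp]: "const c \<in> laurent_in V"
  and X_in_laurent_in [simp]: "X i \<in> laurent_in V"
  and Xinv_in_laurent_in: "i \<in> V \<Longrightarrow> Xinv i \<in> laurent_in V"
  by (auto simp: laurent_in_def const_def X_def Xinv_def lookup_single when_def)

lemma polyring_subset_laurent_in: "polyring n \<subseteq> laurent_in V"
  unfolding polyring_def by (rule kalg_subset) auto

definition subst_monomial :: "(nat \<Rightarrow> 's::comm_ring_1) \<Rightarrow> (nat \<Rightarrow> 's) \<Rightarrow> (nat \<Rightarrow>\<^sub>0 int) \<Rightarrow> 's" where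
  "subst_monomial a b m = (\<Prod>i\<in>Poly_Mapping.keys m.
     if 0 \<le> Poly_Mapping.lookup m i then a i ^ nat (Poly_Mapping.lookup m i)
     else b i ^ nat (- Poly_Mapping.lookup m i))"

text \<open>The inverse of \<open>x\<^sub>i\<close> is sent to \<open>b i\<close>, so \<open>subst h a b\<close> is multiplicative only on Laurent
  polynomials in which the \<open>x\<^sub>i\<close> with \<open>a i * b i \<noteq> 1\<close> have nonnegative exponents.\<close>

definition subst :: "('k \<Rightarrow> 's) \<Rightarrow> (nat \<Rightarrow> 's::comm_ring_1) \<Rightarrow> (nat \<Rightarrow> 's) \<Rightarrow> 'k::field laurent \<Rightarrow> 's" where
  "subst h a b P = (\<Sum>m\<in>Poly_Mapping.keys P. h (Poly_Mapping.lookup P m) * subst_monomial a b m)"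

lemma subst_monomial_superset:
  assumes "finite I" "Poly_Mapping.keys m \<subseteq> I"
  shows "subst_monomial a b m = (\<Prod>i\<in>I.
     if 0 \<le> Poly_Mapping.lookup m i then a i ^ nat (Poly_Mapping.lookup m i)
     else b i ^ nat (- Poly_Mapping.lookup m i))"
  unfolding subst_monomial_def
  by (rule prod.mono_neutral_left) (use assms in \<open>auto simp: in_keys_iff\<close>)

lemma power_nat_mult_inverse:
  fixes a b :: "'s::comm_ring_1"
  assumes "a * b = 1" "0 \<le> u" "0 \<le> v"
  shows "a ^ nat u * b ^ nat v = (if v \<le> u then a ^ nat (u - v) else b ^ nat (v - u))"
proof (cases "v \<le> u")
  case True
  then have "nat u = nat (u - v) + nat v" using assms by simp
  then have "a ^ nat u * b ^ nat v = a ^ nat (u - v) * (a * b) ^ nat v"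
    by (simp only: power_add power_mult_distrib mult.assoc)
  then show ?thesis using True assms by simp
next
  case False
  then have "nat v = nat u + nat (v - u)" using assms by simp
  then have "a ^ nat u * b ^ nat v = b ^ nat (v - u) * (a * b) ^ nat u"
    by (simp only: power_add power_mult_distrib ac_simps)
  then show ?thesis using False assms by simp
qed

lemma subst_monomial_add:
  fixes a b :: "nat \<Rightarrow> 's::comm_ring_1"
  assumes ab: "\<And>i. i \<in> V \<Longrightarrow> a i * b i = 1"
    and m: "\<And>i. i \<notin> V \<Longrightarrow> 0 \<le> Poly_Mapping.lookup m i"
    and m': "\<And>i. i \<notin> V \<Longrightarrow> 0 \<le> Poly_Mapping.lookup m' i"
  shows "subst_monomial a b (m + m') = subst_monomial a b m * subst_monomial a b m'"
proof -
  let ?w = "\<lambda>i e. if 0 \<le> e then a i ^ nat e else b i ^ nat (- e)"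
  have *: "?w i (s + t) = ?w i s * ?w i t"
    if st: "i \<notin> V \<longrightarrow> 0 \<le> s \<and> 0 \<le> t" for i and s t :: int
  proof (cases "(0 \<le> s) = (0 \<le> t)")
    case True
    have "nat (- (s + t)) = nat (- s) + nat (- t)" if "s < 0" "t < 0"
      using that by simp
    with True show ?thesis
      by (cases "0 \<le> s") (auto simp: nat_add_distrib power_add)
  next
    case False
    \<comment> \<open>For opposite signs one exponent is negative, so \<open>i\<close> lies in
      \<open>V\<close> and the two powers cancel against each other.\<close>
    with st have "a i * b i = 1" using ab by blast
    with False show ?thesis
      using power_nat_mult_inverse[of "a i" "b i" s "- t"] power_nat_mult_inverse[of "a i" "b i" t "- s"]
      by (cases "0 \<le> s") (auto simp: mult.commute add.commute minus_diff_commute)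
  qed
  \<comment> \<open>Exponents can cancel in \<open>m + m'\<close>, so all three products are
    extended to the union of the two supports.\<close>
  let ?I = "Poly_Mapping.keys m \<union> Poly_Mapping.keys m'"
  have "subst_monomial a b (m + m') = (\<Prod>i\<in>?I. ?w i (Poly_Mapping.lookup m i + Poly_Mapping.lookup m' i))"
    using subst_monomial_superset[of ?I "m + m'" a b, unfolded lookup_add] Poly_Mapping.keys_add[of m m']
    by simp
  also have "\<dots> = (\<Prod>i\<in>?I. ?w i (Poly_Mapping.lookup m i)) * (\<Prod>i\<in>?I. ?w i (Poly_Mapping.lookup m' i))"
    unfolding prod.distrib[symmetric] by (rule prod.cong) (use * m m' in auto)
  also have "\<dots> = subst_monomial a b m * subst_monomial a b m'"
    using subst_monomial_superset[of ?I m a b] subst_monomial_superset[of ?I m' a b] by simp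
  finally show ?thesis .
qed

section \<open>Additivity and multiplicativity of substitution\<close>

context
  fixes h :: "'k::field \<Rightarrow> 's::comm_ring_1"
  assumes h: "is_ring_hom_on UNIV h"
begin

lemma subst_superset:
  assumes "finite I" "Poly_Mapping.keys P \<subseteq> I"
  shows "subst h a b P = (\<Sum>m\<in>I. h (Poly_Mapping.lookup P m) * subst_monomial a b m)"
  unfolding subst_def
  by (rule sum.mono_neutral_left) (use assms in \<open>auto simp: in_keys_iff hom_zero[OF _ h] is_subring_def\<close>)

lemma subst_add: "subst h a b (P + Q) = subst h a b P + subst h a b Q"
proof -
  let ?I = "Poly_Mapping.keys P \<union> Poly_Mapping.keys Q"
  have "subst h a b (P + Q) = (\<Sum>m\<in>?I. h (Poly_Mapping.lookup (P + Q) m) * subst_monomial a b m)"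
    by (rule subst_superset) (use Poly_Mapping.keys_add[of P Q] in auto)
  then show ?thesis
    by (simp add: subst_superset[of ?I P] subst_superset[of ?I Q] lookup_add hom_add[OF h]
        distrib_right sum.distrib)
qed

lemma subst_zero [simp]: "subst h a b 0 = 0"
  by (simp add: subst_def)

lemma subst_sum: "subst h a b (sum g I) = (\<Sum>i\<in>I. subst h a b (g i))"
  by (induction I rule: infinite_finite_induct) (simp_all add: subst_add)

lemma subst_single: "subst h a b (Poly_Mapping.single m c) = h c * subst_monomial a b m"
  using subst_superset[of "{m}" "Poly_Mapping.single m c" a b] by (auto simp: lookup_single when_def)

lemma sum_monomials: "(\<Sum>m\<in>Poly_Mapping.keys P. Poly_Mapping.single m (Poly_Mapping.lookup P m)) = P"
  by (rule poly_mapping_eqI)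
     (auto simp: lookup_sum lookup_single when_def in_keys_iff)

lemma subst_mult:
  assumes "\<And>i. i \<in> V \<Longrightarrow> a i * b i = 1" and "P \<in> laurent_in V" and "Q \<in> laurent_in V"
  shows "subst h a b (P * Q) = subst h a b P * subst h a b Q"
proof -
  let ?p = "Poly_Mapping.lookup P" and ?q = "Poly_Mapping.lookup Q"
  have "P * Q = (\<Sum>m\<in>Poly_Mapping.keys P. \<Sum>m'\<in>Poly_Mapping.keys Q.
      Poly_Mapping.single (m + m') (?p m * ?q m'))"
    using sum_product[of "\<lambda>m. Poly_Mapping.single m (?p m)" "Poly_Mapping.keys P"
        "\<lambda>m. Poly_Mapping.single m (?q m)" "Poly_Mapping.keys Q"]
    unfolding sum_monomials mult_single .
  also have "subst h a b \<dots> = (\<Sum>m\<in>Poly_Mapping.keys P. \<Sum>m'\<in>Poly_Mapping.keys Q.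
      (h (?p m) * subst_monomial a b m) * (h (?q m') * subst_monomial a b m'))"
    unfolding subst_sum subst_single
  proof (intro sum.cong refl)
    fix m m' assume "m \<in> Poly_Mapping.keys P" "m' \<in> Poly_Mapping.keys Q"
    with assms have "subst_monomial a b (m + m') = subst_monomial a b m * subst_monomial a b m'"
      by (intro subst_monomial_add[of V]) (auto simp: laurent_in_def)
    then show "h (?p m * ?q m') * subst_monomial a b (m + m') =
        (h (?p m) * subst_monomial a b m) * (h (?q m') * subst_monomial a b m')"
      by (simp add: hom_mult[OF h] ac_simps)
  qed
  also have "\<dots> = subst h a b P * subst h a b Q"
    by (simp add: subst_def sum_product)
  finally show ?thesis .
qed

lemma subst_const: "subst h a b (const c) = h c"
  by (simp add: const_def subst_single subst_monomial_def)

lemma subst_X: "subst h a b (X i) = a i"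
  by (simp add: X_def subst_single subst_monomial_def hom_one[OF h])

lemma subst_Xinv: "subst h a b (Xinv i) = b i"
  by (simp add: Xinv_def subst_single subst_monomial_def hom_one[OF h])

lemma subst_hom:
  assumes "\<And>i. i \<in> V \<Longrightarrow> a i * b i = 1"
  shows "is_ring_hom_on (laurent_in V) (subst h a b)"
  using subst_const[of a b 1] subst_mult[of V a b] assms
  by (simp add: is_ring_hom_on_def subst_add hom_one[OF h])

end

lemma const_hom: "is_ring_hom_on UNIV const"
  by (simp add: is_ring_hom_on_def const_add const_mult)

lemma const_pCons_hom: "is_ring_hom_on UNIV (\<lambda>c. [:const c:])"
  by (simp add: is_ring_hom_on_def const_add const_mult one_pCons)

section \<open>Actions given by translations of generators\<close>

lemma poly_hom: "is_ring_hom_on UNIV (\<lambda>q. poly q x)"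
  by (simp add: is_ring_hom_on_def)

lemma map_poly_hom:
  assumes B: "is_subring B" and h: "is_ring_hom_on B h"
  shows "is_ring_hom_on {q. \<forall>i. coeff q i \<in> B} (map_poly h)"
  unfolding is_ring_hom_on_def
proof (intro conjI ballI)
  note [simp] = hom_zero[OF B h]
  show "map_poly h 1 = 1" by (simp add: map_poly_1' hom_one[OF h])
  fix u v assume "u \<in> {q. \<forall>i. coeff q i \<in> B}" "v \<in> {q. \<forall>i. coeff q i \<in> B}"
  then have uv: "coeff u i \<in> B" "coeff v i \<in> B" for i by auto
  show "map_poly h (u + v) = map_poly h u + map_poly h v"
    by (rule poly_eqI) (simp add: coeff_map_poly hom_add[OF h] uv)
  show "map_poly h (u * v) = map_poly h u * map_poly h v"
    by (rule poly_eqI)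
       (simp add: coeff_map_poly coeff_mult hom_sum[OF B h] hom_mult[OF h] subring_mult[OF B] uv)
qed

text \<open>Identifies the left side of the coaction axiom in \<open>Ga_action\<close> with
  \<open>map_poly E (E b)\<close>, which is visibly multiplicative in \<open>b\<close>.\<close>

lemma map_poly_conv_sum:
  assumes "h 0 = 0"
  shows "map_poly h q = (\<Sum>i\<le>degree q. [:h (coeff q i):] * [:0, 1:] ^ i)"
proof (rule poly_eqI)
  fix j
  have "[:h (coeff q i):] * [:0, 1:] ^ i = monom (h (coeff q i)) i" for i
    by (simp add: monom_altdef)
  then have "coeff (\<Sum>i\<le>degree q. [:h (coeff q i):] * [:0, 1:] ^ i) j =
      (\<Sum>i\<le>degree q. if i = j then h (coeff q i) else 0)"
    by (simp add: coeff_sum)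
  also have "\<dots> = h (coeff q j)"
    using coeff_eq_0[of q j] assms by (auto simp: sum.delta' not_le)
  finally show "coeff (map_poly h q) j = coeff (\<Sum>i\<le>degree q. [:h (coeff q i):] * [:0, 1:] ^ i) j"
    using assms by (simp add: coeff_map_poly)
qed

text \<open>Both axioms are equations between ring homomorphisms in \<open>b\<close>, so they only
  need checking on generators. For a translated generator both sides of the second one are x + T_1 +
  T_2.\<close>

lemma Ga_action_adjoinI:
  fixes E :: "'a::comm_ring_1 \<Rightarrow> 'a poly" and R S :: "'a set"
  defines "B \<equiv> adjoin R S"
  assumes E: "is_ring_hom_on B E"
    and R: "\<And>x. x \<in> R \<Longrightarrow> E x = [:x:]"
    and S: "\<And>x. x \<in> S \<Longrightarrow> E x = [:x:] \<or> E x = [:x, 1:]"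
  shows "Ga_action B E"
proof -
  let ?C = "{q. \<forall>i. coeff q i \<in> B}"
  have B: "is_subring B" and RB: "R \<subseteq> B" and SB: "S \<subseteq> B"
    by (auto simp: B_def adjoin_base adjoin_generator)
  note E0 = hom_zero[OF B E] and E1 = hom_one[OF E]
  have "E ` B \<subseteq> ?C"
  proof (rule hom_image_adjoin[OF B E is_subring_poly_coeffs[OF B] RB SB, folded B_def])
    show "E ` R \<subseteq> ?C"
      using R RB subring_zero[OF B] by (auto simp: coeff_pCons split: nat.split)
    show "E ` S \<subseteq> ?C"
    proof clarify
      fix x i assume "x \<in> S"
      with S[OF this] SB show "coeff (E x) i \<in> B"
        using subring_zero[OF B] subring_one[OF B] by (auto simp: coeff_pCons split: nat.split)
    qed
  qed
  moreover have "poly (E b) 0 = b" if "b \<in> B" for b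
    by (rule hom_eq_on_adjoin[OF B hom_comp[OF E poly_hom] hom_id RB SB _ _ that[unfolded B_def]])
       (use R S in fastforce)+
  moreover have "(\<Sum>i\<le>degree (E b). [:E (coeff (E b) i):] * [:0, 1:] ^ i) =
       (\<Sum>i\<le>degree (E b). [:[:coeff (E b) i:]:] * ([:[:0, 1:]:] + [:0, 1:]) ^ i)"
    if "b \<in> B" for b
  proof -
    \<comment> \<open>\<open>?cc\<close> embeds the ring as constants of B[T_1][T_2], and
      \<open>?w\<close> is T_1 + T_2. Thus the right side of the axiom becomes an evaluation at
      \<open>?w\<close>.\<close>
    let ?cc = "\<lambda>c::'a. [:[:c:]:]" and ?w = "[:[:0, 1:]:] + [:0, 1:] :: 'a poly poly"
    have "is_ring_hom_on UNIV ?cc"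
      by (simp add: is_ring_hom_on_def one_pCons)
    then have cc: "is_ring_hom_on UNIV (map_poly ?cc)"
      using map_poly_hom[of UNIV ?cc] by (simp add: is_subring_def)
    have h: "is_ring_hom_on B (\<lambda>b. map_poly E (E b))"
      by (rule hom_comp[OF E map_poly_hom[OF B E]]) fact
    have g: "is_ring_hom_on B (\<lambda>b. poly (map_poly ?cc (E b)) ?w)"
      by (rule hom_comp[OF E hom_comp[OF cc poly_hom]]) auto
    have "map_poly E (E b) = poly (map_poly ?cc (E b)) ?w"
    proof (rule hom_eq_on_adjoin[OF B h g RB SB _ _ that[unfolded B_def]])
      show "map_poly E (E x) = poly (map_poly ?cc (E x)) ?w" if "x \<in> R" for x
        using R[OF that] by (simp add: map_poly_pCons E0)
      show "map_poly E (E x) = poly (map_poly ?cc (E x)) ?w" if "x \<in> S" for x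
        using S[OF that] by (auto simp: map_poly_pCons E0 E1 one_pCons)
    qed
    also have "\<dots> = (\<Sum>i\<le>degree (E b). ?cc (coeff (E b) i) * ?w ^ i)"
      by (simp only: poly_altdef) (simp add: degree_map_poly coeff_map_poly)
    finally show ?thesis
      by (simp only: map_poly_conv_sum[of E, OF E0])
  qed
  ultimately show ?thesis
    using B E by (auto simp: Ga_action_def restricts_to_def)
qed

section \<open>The action on the Laurent polynomial ring\<close>

lemma is_subring_laurent_base [simp]: "is_subring (laurent_base n)"
  and is_subring_laurent_ring [simp]: "is_subring (laurent_ring n)"
  by (simp_all add: laurent_base_def laurent_ring_def)

lemma const_in_laurent_base [simp]: "const c \<in> laurent_base n"
  and X_in_laurent_base [simp]: "X n \<in> laurent_base n"
  and Xinv_in_laurent_base [simp]: "Xinv n \<in> laurent_base n"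
  by (simp_all add: laurent_base_def kalg_generator)

lemma laurent_base_subset: "laurent_base n \<subseteq> laurent_ring n"
  by (auto simp: laurent_ring_def adjoin_base)

lemma const_in_laurent_ring [simp]: "const c \<in> laurent_ring n"
  and Xinv_in_laurent_ring [simp]: "Xinv n \<in> laurent_ring n"
  by (rule subsetD[OF laurent_base_subset], simp)+

lemma X_in_laurent_ring: "1 \<le> i \<Longrightarrow> i \<le> n \<Longrightarrow> X i \<in> laurent_ring n"
  using laurent_base_subset[of n]
  by (cases "i = n") (auto simp: laurent_ring_def intro: adjoin_generator)

lemma polyring_subset_laurent_ring: "polyring n \<subseteq> laurent_ring n"
  unfolding polyring_def by (rule kalg_subset) (auto simp: X_in_laurent_ring)

lemma laurent_ring_subset_laurent_in: "laurent_ring n \<subseteq> laurent_in {n}"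
  unfolding laurent_ring_def laurent_base_def
  by (intro adjoin_subset kalg_subset) (auto simp: Xinv_in_laurent_in)

lemma f_1: "f p n r 1 = X 1 + Xinv n * X r ^ p"
  and f_middle: "2 \<le> i \<Longrightarrow> i \<le> r \<Longrightarrow> f p n r i = X i + Xinv n * (\<Sum>j\<in>{2..<i}. X j ^ p)
    + X n ^ (p - 1) * (f p n r 1 ^ p - f p n r 1)"
  and f_last: "r < i \<Longrightarrow> i \<noteq> 1 \<Longrightarrow> f p n r i = X i"
  by (auto simp: f_def f1_def)

lemma f_in_laurent_ring:
  assumes "1 \<le> r" "r < n" "1 \<le> i" "i < n"
  shows "f p n r i \<in> laurent_ring n"
  using assms by (auto simp: f_def f1_def intro!: subring_closed X_in_laurent_ring)

text \<open>The system is triangular: for 2 \<le> i \<le> r, f_i - x_i involves only f_1, powers of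
  x_n and the x_j with 2 \<le> j < i. So x_2, x_3, ... are recovered in turn.\<close>

lemma adjoin_f_eq_laurent_ring:
  assumes "2 \<le> r" "r < n"
  shows "adjoin (laurent_base n) (f p n r ` {1..n - 1}) = (laurent_ring n :: 'k::field laurent set)"
    (is "?B = _")
proof
  show "?B \<subseteq> laurent_ring n"
    using assms by (intro adjoin_subset) (auto simp: laurent_base_subset intro!: f_in_laurent_ring)
  have B: "is_subring ?B" by simp
  have base: "X n \<in> ?B" "Xinv n \<in> ?B" by (auto intro: adjoin_base)
  have f: "f p n r i \<in> ?B" if "1 \<le> i" "i < n" for i
    using that by (auto intro!: adjoin_generator)
  have X: "X i \<in> ?B" if "2 \<le> i" "i < n" for i
    using that
  proof (induction i rule: less_induct)
    case (less i)
    show ?case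
    proof (cases "i \<le> r")
      case True
      with less.prems have "X i = f p n r i - Xinv n * (\<Sum>j\<in>{2..<i}. X j ^ p)
          - X n ^ (p - 1) * (f p n r 1 ^ p - f p n r 1)"
        by (simp add: f_middle)
      also have "\<dots> \<in> ?B"
        using less.prems by (intro subring_closed[OF B] base f less.IH) auto
      finally show ?thesis .
    next
      case False
      with less.prems f[of i] show ?thesis by (simp add: f_last)
    qed
  qed
  \<comment> \<open>The variable x_1 comes last, since f_1 involves x_r.\<close>
  have "X 1 = f p n r 1 - Xinv n * X r ^ p" unfolding f_1 by simp
  also have "\<dots> \<in> ?B"
    using assms by (intro subring_closed[OF B] base f X) auto
  finally have "X i \<in> ?B" if "1 \<le> i" "i < n" for i
    using X[of i] that by (cases "i = 1") auto
  then show "laurent_ring n \<subseteq> ?B"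
    unfolding laurent_ring_def by (intro adjoin_subset) (auto intro: adjoin_base)
qed

lemma is_E_tilde_base:
  "is_E_tilde p n r E \<Longrightarrow> x \<in> laurent_base n \<Longrightarrow> E x = [:x:]"
  by (auto simp: is_E_tilde_def invariants_def)

lemma is_E_tilde_hom: "is_E_tilde p n r E \<Longrightarrow> is_ring_hom_on (laurent_ring n) E"
  by (simp add: is_E_tilde_def Ga_action_def)

lemma is_E_tilde_f1: "is_E_tilde p n r E \<Longrightarrow> E (f p n r 1) = [:f p n r 1, 1:]"
  by (simp add: is_E_tilde_def)

lemma is_E_tilde_f: "is_E_tilde p n r E \<Longrightarrow> 2 \<le> i \<Longrightarrow> i < n \<Longrightarrow> E (f p n r i) = [:f p n r i:]"
  by (auto simp: is_E_tilde_def)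

lemma is_E_tilde_unique:
  assumes "2 \<le> r" "r < n" and E: "is_E_tilde p n r E" and E': "is_E_tilde p n r E'"
    and b: "b \<in> laurent_ring n"
  shows "E b = E' b"
proof -
  have "E x = E' x" if "x \<in> f p n r ` {1..n - 1}" for x
  proof -
    from that obtain i where "1 \<le> i" "i < n" "x = f p n r i" by fastforce
    then show ?thesis
      using is_E_tilde_f[OF E, of i] is_E_tilde_f[OF E', of i] is_E_tilde_f1[OF E]
        is_E_tilde_f1[OF E'] by (cases "i = 1") auto
  qed
  moreover have "f p n r ` {1..n - 1} \<subseteq> laurent_ring n"
    using assms(1,2) by (auto intro!: f_in_laurent_ring)
  moreover have "E x = E' x" if "x \<in> laurent_base n" for x
    using that by (simp add: is_E_tilde_base[OF E] is_E_tilde_base[OF E'])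
  moreover have "b \<in> adjoin (laurent_base n) (f p n r ` {1..n - 1})"
    using b by (simp only: adjoin_f_eq_laurent_ring[OF assms(1,2)])
  ultimately show ?thesis
    using hom_eq_on_adjoin[OF is_subring_laurent_ring is_E_tilde_hom[OF E] is_E_tilde_hom[OF E']
        laurent_base_subset] by blast
qed

text \<open>The equation for \<open>f i\<close> solved for \<open>x\<^sub>i\<close>, with \<open>f 1\<close> replaced by \<open>f 1 + T\<close>.\<close>

function X_image :: "nat \<Rightarrow> nat \<Rightarrow> nat \<Rightarrow> nat \<Rightarrow> 'k::field laurent poly" where
  "X_image p n r i = [:f p n r i:] - [:Xinv n:] * (\<Sum>j\<in>{2..<i}. X_image p n r j ^ p)
     - [:X n:] ^ (p - 1) * ([:f p n r 1, 1:] ^ p - [:f p n r 1, 1:])"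
  by auto
termination by (relation "measure (\<lambda>(p, n, r, i). i)") auto

declare X_image.simps [simp del]

text \<open>The images of the variables are forced by the prescribed values on the f_i. The value at
  x_1 solves f_1 + T = E(x_1) + x_n^(-1) E(x_r)^p, once the image of x_r is known.\<close>

definition E_std :: "nat \<Rightarrow> nat \<Rightarrow> nat \<Rightarrow> 'k::field laurent \<Rightarrow> 'k laurent poly" where
  "E_std p n r = subst (\<lambda>c. [:const c:])
     (\<lambda>i. if i = 1 then [:f p n r 1, 1:] - [:Xinv n:] * X_image p n r r ^ p
          else if i \<le> r then X_image p n r i else [:X i:]) (\<lambda>i. [:Xinv i:])"

text \<open>Since x_n and its inverse are sent to themselves, the substitution is a homomorphism on
  the Laurent ring. The choice of the images then gives the values on the f_i by direct
  computation.\<close>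

lemma is_E_tilde_E_std:
  assumes "2 \<le> r" "r < n"
  shows "is_E_tilde p n r (E_std p n r :: 'k::field laurent \<Rightarrow> 'k laurent poly)" (is "is_E_tilde p n r ?E")
proof -
  note c = const_pCons_hom and L = is_subring_laurent_ring
  have E: "is_ring_hom_on (laurent_ring n) ?E"
    unfolding E_std_def
    by (rule hom_subset[OF subst_hom[OF c] laurent_ring_subset_laurent_in])
       (use assms in \<open>auto simp: Xinv_mult_X X_mult_Xinv one_pCons\<close>)
  note hom = hom_add[OF E] hom_mult[OF E] hom_diff[OF L E] hom_power[OF L E] hom_sum[OF L E]
  have const: "?E (const d) = [:const d:]" for d by (simp add: E_std_def subst_const[OF c])
  have Xn: "?E (X n) = [:X n:]" using assms by (simp add: E_std_def subst_X[OF c])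
  have Xinv: "?E (Xinv n) = [:Xinv n:]" by (simp add: E_std_def subst_Xinv[OF c])
  have X1: "?E (X 1) = [:f p n r 1, 1:] - [:Xinv n:] * X_image p n r r ^ p"
    by (simp add: E_std_def subst_X[OF c])
  have X: "?E (X i) = X_image p n r i" if "2 \<le> i" "i \<le> r" for i
    using that by (simp add: E_std_def subst_X[OF c])
  have f1: "?E (f p n r 1) = [:f p n r 1, 1:]"
  proof -
    have "?E (f p n r 1) = ?E (X 1) + [:Xinv n:] * ?E (X r) ^ p"
      unfolding f_1 using assms by (simp add: hom X_in_laurent_ring subring_closed Xinv)
    then show ?thesis using assms by (simp only: X1 X) simp
  qed
  have f: "?E (f p n r i) = [:f p n r i:]" if i: "2 \<le> i" "i < n" for i
  proof (cases "i \<le> r")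
    case True
    have s: "?E (\<Sum>j\<in>{2..<i}. X j ^ p) = (\<Sum>j\<in>{2..<i}. X_image p n r j ^ p)"
      using i True assms by (subst hom_sum[OF L E])
        (auto simp: hom X X_in_laurent_ring intro!: subring_closed sum.cong)
    let ?L = "laurent_ring n :: 'k laurent set"
    have *: "X i \<in> ?L" "X n \<in> ?L" "f p n r 1 \<in> ?L" "(\<Sum>j\<in>{2..<i}. X j ^ p) \<in> ?L"
      using i assms by (auto intro!: subring_closed X_in_laurent_ring f_in_laurent_ring)
    have "?E (f p n r i) = ?E (X i) + [:Xinv n:] * (\<Sum>j\<in>{2..<i}. X_image p n r j ^ p)
        + [:X n:] ^ (p - 1) * ([:f p n r 1, 1:] ^ p - [:f p n r 1, 1:])"
      unfolding f_middle[OF i(1) True] 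

      using * by (simp add: hom subring_closed s f1 Xinv Xn del: One_nat_def)

    then show ?thesis
      using i True by (simp only: X X_image.simps[of p n r i]) simp
  next
    case False
    then show ?thesis using i by (simp add: f_last E_std_def subst_X[OF c])
  qed
  have base: "laurent_base n \<subseteq> invariants (laurent_ring n) ?E"
    unfolding laurent_base_def
    using is_subring_invariants[OF L E]
    by (rule kalg_subset) (use assms in \<open>auto simp: invariants_def const Xn Xinv X_in_laurent_ring\<close>)
  have "Ga_action (laurent_ring n) ?E"
    \<comment> \<open>Viewed as generated by the f_i, the ring has generators that are fixed or
      translated by T, so the criterion for such maps applies.\<close>
    unfolding adjoin_f_eq_laurent_ring[OF assms, of p, symmetric]
  proof (rule Ga_action_adjoinI)
    show "is_ring_hom_on (adjoin (laurent_base n) (f p n r ` {1..n - 1})) ?E"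
      using E by (simp only: adjoin_f_eq_laurent_ring[OF assms])
    show "?E x = [:x:]" if "x \<in> laurent_base n" for x
      using base that by (auto simp: invariants_def)
    show "?E x = [:x:] \<or> ?E x = [:x, 1:]" if "x \<in> f p n r ` {1..n - 1}" for x
    proof -
      from that obtain i where "1 \<le> i" "i < n" "x = f p n r i" by fastforce
      then show ?thesis using f[of i] f1 by (cases "i = 1") auto
    qed
  qed
  with base f1 f show ?thesis
    by (auto simp: is_E_tilde_def)
qed

section \<open>Restriction to the polynomial ring\<close>

text \<open>Integers are constants and k embeds as constants, so the same integers vanish in both
  rings. This makes the Frobenius identity available over the Laurent ring.\<close>

lemma CHAR_laurent [simp]: "CHAR('k::field laurent) = CHAR('k)"
proof (rule CHAR_eqI)
  have *: "of_nat m = (const (of_nat m) :: 'k laurent)" for m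
    by (simp add: const_def)
  show "of_nat CHAR('k) = (0 :: 'k laurent)" by (simp add: *)
  fix m assume "of_nat m = (0 :: 'k laurent)"
  then have "Poly_Mapping.lookup (const (of_nat m) :: 'k laurent) 0 = 0" by (simp add: *)
  then show "CHAR('k) dvd m" by (simp add: const_def lookup_of_nat of_nat_eq_0_iff_char_dvd)
qed

lemma frobenius_add:
  fixes a b :: "'k::field laurent poly"
  assumes "CHAR('k) = p" "p > 0"
  shows "(a + b) ^ p = a ^ p + b ^ p"
proof -
  have "prime p" using assms prime_CHAR_semidom[where 'a = 'k] by auto
  then show ?thesis by (intro freshmans_dream) (simp_all add: assms)
qed

text \<open>The exponent count p(p-1) - 1 = (p-1) + p(p-2): one factor x_n^(-1) is absorbed and
  x_n^(p-1) can still be split off.\<close>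

lemma Xinv_mult_X_power:
  assumes "p \<ge> 2"
  shows "Xinv n * (X n ^ (p - 1)) ^ p = (X n ^ (p - 1) * X n ^ (p * (p - 2)) :: 'k::field laurent)"
proof -
  obtain q where "p = q + 2" using assms by (metis add.commute le_Suc_ex)
  then have "(p - 1) * p = 1 + ((p - 1) + p * (p - 2))" by (simp add: algebra_simps)
  then have "(X n ^ (p - 1)) ^ p = (X n * (X n ^ (p - 1) * X n ^ (p * (p - 2))) :: 'k laurent)"
    unfolding power_mult[symmetric] by (simp only: power_add power_one_right)
  then show ?thesis by (simp add: Xinv_mult_X flip: mult.assoc)
qed

section \<open>The values of the action on the variables\<close>

context
  fixes p n r :: nat and E :: "'k::field laurent \<Rightarrow> 'k laurent poly"
  assumes p: "CHAR('k) = p" "p > 0" and r: "2 \<le> r" "r < n" and tilde: "is_E_tilde p n r E"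
begin

lemma p_ge_2: "p \<ge> 2"
  using p prime_CHAR_semidom[where 'a = 'k] prime_ge_2_nat by blast

lemma
  shows E_const: "E (const c) = [:const c:]"
    and E_Xn: "E (X n) = [:X n:]"
    and E_Xinv: "E (Xinv n) = [:Xinv n:]"
  by (simp_all add: is_E_tilde_base[OF tilde])

lemmas E_hom = is_E_tilde_hom[OF tilde]

lemmas E_simps = hom_add[OF E_hom] hom_mult[OF E_hom] hom_diff[OF is_subring_laurent_ring E_hom]
  hom_power[OF is_subring_laurent_ring E_hom] hom_sum[OF is_subring_laurent_ring E_hom]

text \<open>The induction has to carry the factor x_n^(p-1), because its p-th power is what absorbs
  x_n^(-1) at the next index. The condition at T = 1 is carried along to identify E_1.\<close>

lemma E_X_middle:
  assumes "2 \<le> i" "i \<le> r"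
  shows "\<exists>q. (\<forall>j. coeff q j \<in> polyring n) \<and> poly q 1 = 0 \<and> E (X i) = [:X i:] + [:X n ^ (p - 1):] * q"
  using assms
proof (induction i rule: less_induct)
  case (less i)
  let ?L = "laurent_ring n :: 'k laurent set"
  let ?z = "X n :: 'k laurent" and ?T = "[:0, 1:] :: 'k laurent poly"
  from less have "\<forall>j\<in>{2..<i}. \<exists>q. (\<forall>k. coeff q k \<in> polyring n) \<and> poly q 1 = 0 \<and>
      E (X j) = [:X j:] + [:X n ^ (p - 1):] * q" by auto
  then obtain q where q: "coeff (q j) k \<in> polyring n" "poly (q j) 1 = 0"
      "E (X j) = [:X j:] + [:?z ^ (p - 1):] * q j" if "j \<in> {2..<i}" for j k
    by metis
  have pow: "E (X j) ^ p = [:X j:] ^ p + [:?z ^ (p - 1):] ^ p * q j ^ p" if "j \<in> {2..<i}" for j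
    by (simp only: q(3)[OF that] frobenius_add[OF p] power_mult_distrib)
  have *: "X i \<in> ?L" "X n \<in> ?L" "f p n r 1 \<in> ?L" "(\<Sum>j\<in>{2..<i}. X j ^ p) \<in> ?L"
    using less.prems r by (auto intro!: subring_closed X_in_laurent_ring f_in_laurent_ring)
  have s: "E (\<Sum>j\<in>{2..<i}. X j ^ p) = (\<Sum>j\<in>{2..<i}. E (X j) ^ p)"
    using less.prems r by (subst E_simps(5)) (auto simp: E_simps X_in_laurent_ring intro!: subring_closed)
  have "[:f p n r i:] = E (f p n r i)"
    using less.prems r by (simp add: is_E_tilde_f[OF tilde])
  also have "\<dots> = E (X i) + [:Xinv n:] * (\<Sum>j\<in>{2..<i}. E (X j) ^ p)
      + [:?z:] ^ (p - 1) * ([:f p n r 1, 1:] ^ p - [:f p n r 1, 1:])"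
    unfolding f_middle[OF less.prems] using *
    by (simp only: E_simps subring_closed is_subring_laurent_ring s is_E_tilde_f1[OF tilde]
        E_Xn E_Xinv Xinv_in_laurent_ring)
  also have "(\<Sum>j\<in>{2..<i}. E (X j) ^ p) =
      (\<Sum>j\<in>{2..<i}. [:X j:] ^ p) + [:?z ^ (p - 1):] ^ p * (\<Sum>j\<in>{2..<i}. q j ^ p)"
    unfolding sum_distrib_left sum.distrib[symmetric] by (rule sum.cong) (simp_all only: pow)
  also have "[:f p n r 1, 1:] = [:f p n r 1:] + ?T" by simp
  also have "([:f p n r 1:] + ?T) ^ p = [:f p n r 1:] ^ p + ?T ^ p"
    by (rule frobenius_add[OF p])
  finally have eq: "[:f p n r i:] = E (X i) + [:Xinv n:] * ((\<Sum>j\<in>{2..<i}. [:X j:] ^ p)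
      + [:?z ^ (p - 1):] ^ p * (\<Sum>j\<in>{2..<i}. q j ^ p))
      + [:?z:] ^ (p - 1) * ([:f p n r 1:] ^ p + ?T ^ p - ([:f p n r 1:] + ?T))" .
  have pC: "[:a + b:] = [:a:] + [:b:]" "[:a - b:] = [:a:] - [:b:]" "[:a * b:] = [:a:] * [:b:]"
    "[:a ^ k:] = [:a:] ^ k" for a b :: "'k laurent" and k
    by (simp_all add: poly_const_pow)
  have pCs: "[:sum g I:] = (\<Sum>i\<in>I. [:g i:])" for g :: "nat \<Rightarrow> 'k laurent" and I
    by (induction I rule: infinite_finite_induct) (auto simp: pC(1))
  have z: "[:Xinv n:] * [:?z ^ (p - 1):] ^ p = [:?z:] ^ (p - 1) * [:?z ^ (p * (p - 2)):]"
    using Xinv_mult_X_power[OF p_ge_2, of n, where 'k = 'k] by (simp only: flip: pC)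
  \<comment> \<open>The sum collects the Frobenius powers of the earlier corrections; T^p - T is the
    change of f_1^p - f_1 under f_1 -> f_1 + T.\<close>
  define Q where "Q = - ([:?z ^ (p * (p - 2)):] * (\<Sum>j\<in>{2..<i}. q j ^ p)) - (?T ^ p - ?T)"
  have f_i: "[:f p n r i:] = [:X i:] + [:Xinv n:] * (\<Sum>j\<in>{2..<i}. [:X j:] ^ p)
      + [:?z:] ^ (p - 1) * ([:f p n r 1:] ^ p - [:f p n r 1:])"
    unfolding f_middle[OF less.prems] by (simp only: pC pCs)
  \<comment> \<open>Comparing the formula for f_i with its image under \<open>E\<close> cancels the
    p-th powers of the variables and the terms in f_1. This is stated for abstract ring elements to
    keep the algebra small.\<close>
  have solve: "e = x - (a * b) * w - c * (t' - t)"
    if "y = x + a * s + c * (g' - g)" "y = e + a * (s + b * w) + c * (g' + t' - (g + t))"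
    for e x y a b c w s g g' t t' :: "'k laurent poly"
  proof -
    have "e = y - a * (s + b * w) - c * (g' + t' - (g + t))" using that(2) by simp
    then show ?thesis unfolding that(1) by (simp add: algebra_simps)
  qed
  have "E (X i) = [:X i:] - ([:Xinv n:] * [:?z ^ (p - 1):] ^ p) * (\<Sum>j\<in>{2..<i}. q j ^ p)
      - [:?z:] ^ (p - 1) * (?T ^ p - ?T)"
    using f_i eq by (rule solve)
  also have "\<dots> = [:X i:] + [:?z ^ (p - 1):] * Q"
    unfolding z Q_def by (simp only: pC(4)) (simp add: algebra_simps)
  finally have EQ: "E (X i) = [:X i:] + [:?z ^ (p - 1):] * Q" .
  have C: "is_subring {q. \<forall>j. coeff q j \<in> (polyring n :: 'k laurent set)}"
    by (rule is_subring_poly_coeffs) simp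
  have "Q \<in> {q. \<forall>j. coeff q j \<in> polyring n}"
    unfolding Q_def
    by (intro subring_closed C; use q(1) r in
      \<open>auto simp: coeff_pCons intro!: subring_closed X_in_polyring split: nat.split\<close>)
  \<comment> \<open>Each \<open>q j\<close> vanishes at T = 1 by induction, and T^p - T does as
    well.\<close>
  moreover have "poly Q 1 = 0"
    using p by (simp add: Q_def poly_sum q(2) power_0_left)
  ultimately show ?case using EQ by auto
qed

lemma E_X_1:
  "\<exists>q. (\<forall>j. coeff q j \<in> polyring n) \<and> poly q 1 = 0 \<and> E (X 1) = [:X 1, 1:] + q"
proof -
  obtain q where q: "\<forall>j. coeff q j \<in> polyring n" "poly q 1 = 0"
    "E (X r) = [:X r:] + [:X n ^ (p - 1):] * q" using E_X_middle[of r] r by auto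
  let ?z = "X n :: 'k laurent"
  \<comment> \<open>This is -x_n^(-1) (x_n^(p-1) q)^p after the exponent count, hence
    polynomial.\<close>
  define Q where "Q = - ([:?z ^ (p - 1) * ?z ^ (p * (p - 2)):] * q ^ p)"
  have C: "is_subring {q. \<forall>j. coeff q j \<in> (polyring n :: 'k laurent set)}"
    by (rule is_subring_poly_coeffs) simp
  have "Q \<in> {q. \<forall>j. coeff q j \<in> polyring n}"
    unfolding Q_def
    by (intro subring_closed C; use q(1) r in
      \<open>auto simp: coeff_pCons intro!: subring_closed X_in_polyring split: nat.split\<close>)
  moreover have "poly Q 1 = 0"
    using p by (simp add: Q_def q(2) power_0_left)
  moreover have "E (X 1) = [:X 1, 1:] + Q"
  proof -
    have "[:f p n r 1, 1:] = E (X 1 + Xinv n * X r ^ p)"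
      using is_E_tilde_f1[OF tilde] unfolding f_1 by (rule sym)
    also have "\<dots> = E (X 1) + [:Xinv n:] * E (X r) ^ p"
      using r by (simp add: E_simps X_in_laurent_ring subring_closed E_Xinv)
    also have "E (X r) ^ p = [:X r:] ^ p + [:?z ^ (p - 1):] ^ p * q ^ p"
      by (simp only: q(3) frobenius_add[OF p] power_mult_distrib)
    also have "[:Xinv n:] * \<dots> = [:Xinv n * X r ^ p:] + [:Xinv n * (?z ^ (p - 1)) ^ p:] * q ^ p"
      by (simp add: distrib_left poly_const_pow ac_simps)
    also have "\<dots> = [:Xinv n * X r ^ p:] - Q"
      by (simp add: Q_def Xinv_mult_X_power[OF p_ge_2] del: One_nat_def)
    finally have "E (X 1) = [:f p n r 1, 1:] - ([:Xinv n * X r ^ p:] - Q)" by simp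
    also have "[:f p n r 1, 1:] = [:X 1, 1:] + [:Xinv n * X r ^ p:]" unfolding f_1 by simp
    finally have "E (X 1) = ([:X 1, 1:] + [:Xinv n * X r ^ p:]) - ([:Xinv n * X r ^ p:] - Q)" .
    moreover have "(a + c) - (c - d) = a + d" for a c d :: "'k laurent poly" by simp
    ultimately show ?thesis by (simp only:)
  qed
  ultimately show ?thesis by blast
qed

lemma E_X_last: "r < i \<Longrightarrow> i \<le> n \<Longrightarrow> E (X i) = [:X i:]"
  using is_E_tilde_f[OF tilde, of i] E_Xn r by (cases "i = n") (auto simp: f_last)

lemma E_restricts_polyring: "restricts_to E (polyring n)"
proof -
  have "\<forall>j. coeff (E (X i)) j \<in> polyring n" if i: "1 \<le> i" "i \<le> n" for i
  proof -
    consider "i = 1" | "2 \<le> i" "i \<le> r" | "r < i" using i by linarith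
    then show ?thesis
    proof cases
      case 1
      with E_X_1 that show ?thesis
        by (auto simp: coeff_pCons intro!: subring_closed X_in_polyring split: nat.split)
    next
      case 2
      with E_X_middle[of i] that r show ?thesis
        by (auto simp: coeff_pCons intro!: subring_closed X_in_polyring split: nat.split)
    next
      case 3
      with E_X_last[of i] that show ?thesis
        by (auto simp: coeff_pCons intro!: subring_closed X_in_polyring split: nat.split)
    qed
  qed
  then have "E ` adjoin (range const) (X ` {1..n}) \<subseteq> {q. \<forall>j. coeff q j \<in> polyring n}"
    by (intro hom_image_adjoin[OF is_subring_laurent_ring E_hom] is_subring_poly_coeffs)
       (auto simp: E_const X_in_laurent_ring coeff_pCons subring_zero split: nat.split)
  then show ?thesis by (auto simp: restricts_to_def polyring_def kalg_def)
qed

lemma E_hom_polyring: "is_ring_hom_on (polyring n) E"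
  using E_hom polyring_subset_laurent_ring by (rule hom_subset)

lemma E_Ga_action_polyring: "Ga_action (polyring n) E"
  using tilde polyring_subset_laurent_ring[of n] E_restricts_polyring E_hom_polyring
  by (auto simp: is_E_tilde_def Ga_action_def)

text \<open>The corrections to x_1, ..., x_r vanish at T = 1 and the later variables are fixed, so
  the two homomorphisms agree on constants and variables.\<close>

lemma action_at_1_eq:
  assumes \<epsilon>: "\<epsilon> \<in> kaut n" "\<epsilon> (X 1) = X 1 + 1" "\<forall>i\<in>{2..n}. \<epsilon> (X i) = X i"
    and b: "b \<in> polyring n"
  shows "action_at E 1 b = \<epsilon> b"
proof -
  have *: "is_ring_hom_on (polyring n) (action_at E 1)"
    unfolding action_at_def using E_hom_polyring poly_hom by (rule hom_comp) simp
  have "action_at E 1 (X i) = \<epsilon> (X i)" if i: "1 \<le> i" "i \<le> n" for i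
  proof -
    consider "i = 1" | "2 \<le> i" "i \<le> r" | "r < i" using i by linarith
    then show ?thesis
    proof cases
      case 1
      with E_X_1 \<epsilon> show ?thesis by (auto simp: action_at_def)
    next
      case 2
      with E_X_middle[of i] \<epsilon> that show ?thesis by (auto simp: action_at_def)
    next
      case 3
      with E_X_last[of i] \<epsilon> that r show ?thesis by (auto simp: action_at_def)
    qed
  qed
  then have gen: "action_at E 1 x = \<epsilon> x" if "x \<in> X ` {1..n}" for x
    using that by auto
  have const: "action_at E 1 x = \<epsilon> x" if "x \<in> range const" for x
    using that \<epsilon>(1) by (auto simp: kaut_def action_at_def E_const)
  have sub: "range const \<subseteq> (polyring n :: 'k laurent set)"
    "X ` {1..n} \<subseteq> (polyring n :: 'k laurent set)"
    by (auto simp: X_in_polyring)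
  have "is_ring_hom_on (polyring n) \<epsilon>"
    using \<epsilon>(1) by (simp add: kaut_def)
  from hom_eq_on_adjoin[OF is_subring_polyring * this sub const gen b[unfolded polyring_def kalg_def]]
  show ?thesis .
qed

end

section \<open>The invariant ring\<close>

lemma X_power: "X i ^ k = Poly_Mapping.single (Poly_Mapping.single i (int k)) (1 :: 'k::field)"
  by (induction k) (simp_all add: X_def mult_single add.commute flip: single_add)

text \<open>Replacing x_i by x_i^(e_i) sends distinct monomials to distinct monomials, so no
  coefficients can cancel.\<close>

lemma subst_powers_eq_0:
  fixes q :: "'k::field laurent"
  assumes q: "q \<in> laurent_in {}" and e: "\<And>i. e i > 0"
    and 0: "subst const (\<lambda>i. X i ^ e i) b q = 0"
  shows "q = 0"
proof (rule ccontr)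
  assume "q \<noteq> 0"
  then obtain m where m: "m \<in> Poly_Mapping.keys q"
    by (metis in_keys_iff lookup_zero poly_mapping_eqI)
  \<comment> \<open>\<open>M k\<close> is the exponent vector of the image of the monomial
    \<open>k\<close>. It determines \<open>k\<close> because every \<open>e i\<close> is
    positive.\<close>
  define M where "M k = (\<Sum>i\<in>Poly_Mapping.keys k. Poly_Mapping.single i (int (e i) * Poly_Mapping.lookup k i))"
    for k :: "nat \<Rightarrow>\<^sub>0 int"
  have lookup_M: "Poly_Mapping.lookup (M k) i = int (e i) * Poly_Mapping.lookup k i" for k i
    by (auto simp: M_def lookup_sum lookup_single when_def in_keys_iff)
  have M_eq: "M k = M l \<longleftrightarrow> k = l" for k l
    by (auto simp: poly_mapping_eq_iff fun_eq_iff lookup_M less_imp_neq[OF e, symmetric])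
  have mono: "subst_monomial (\<lambda>i. X i ^ e i) b k = (Poly_Mapping.single (M k) 1 :: 'k laurent)"
    if "k \<in> Poly_Mapping.keys q" for k
  proof -
    have pos: "0 \<le> Poly_Mapping.lookup k i" for i
      using q that by (auto simp: laurent_in_def)
    have *: "(\<Prod>i\<in>I. Poly_Mapping.single (v i) 1) = (Poly_Mapping.single (sum v I) 1 :: 'k laurent)" for v I
      by (induction I rule: infinite_finite_induct) (simp_all add: mult_single)
    have "(X i ^ e i) ^ nat (Poly_Mapping.lookup k i) =
        Poly_Mapping.single (Poly_Mapping.single i (int (e i) * Poly_Mapping.lookup k i)) (1 :: 'k)" for i
      using pos[of i] by (simp only: power_mult[symmetric]) (simp add: X_power)
    then show ?thesis
      by (simp add: subst_monomial_def pos M_def *)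
  qed
  have "Poly_Mapping.lookup (subst const (\<lambda>i. X i ^ e i) b q) (M m) =
      (\<Sum>k\<in>Poly_Mapping.keys q. if k = m then Poly_Mapping.lookup q k else 0)"
    by (auto simp: subst_def mono const_def mult_single lookup_sum lookup_single when_def M_eq intro!: sum.cong)
  then show False
    using m 0 by (simp add: in_keys_iff)
qed

definition invariant_generators :: "nat \<Rightarrow> nat \<Rightarrow> nat \<Rightarrow> 'k::field laurent set" where
  "invariant_generators p n r = (\<lambda>i. X n * f p n r i) ` {2..r} \<union> X ` {r + 1..n}"

text \<open>The factor x_n clears the denominators, since x_n f_1 = x_n x_1 + x_r^p and x_n *
  x_n^(p-1) f_1^p = (x_n f_1)^p. Reductions modulo x_n and linear parts are read off from this
  form.\<close>

lemma X_mult_f: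
  assumes "2 \<le> i" "i \<le> r" "p > 0"
  shows "X n * f p n r i = X n * X i + (\<Sum>j\<in>{2..<i}. X j ^ p) + (X n * X 1 + X r ^ p) ^ p
    - X n ^ (p - 1) * (X n * X 1 + X r ^ p :: 'k::field laurent)"
proof -
  have f1: "X n * f p n r 1 = (X n * X 1 + X r ^ p :: 'k laurent)"
    unfolding f_1 by (simp add: distrib_left X_mult_Xinv flip: mult.assoc)
  have "X n * X n ^ (p - 1) = (X n ^ p :: 'k laurent)"
    using assms(3) by (simp add: power_eq_if)
  moreover have "z * (y * (g' - g)) = (z * y) * g' - y * (z * g)" for z y g g' :: "'k laurent"
    by (simp add: algebra_simps)
  ultimately have "X n * (X n ^ (p - 1) * (f p n r 1 ^ p - f p n r 1))
      = (X n * f p n r 1) ^ p - X n ^ (p - 1) * (X n * f p n r 1 :: 'k laurent)"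
    by (simp only: power_mult_distrib)
  then show ?thesis
    unfolding f_middle[OF assms(1,2)] distrib_left f1
    by (simp only: mult.assoc[symmetric] X_mult_Xinv mult_1_left) (simp only: add_diff_eq mult.assoc)
qed

lemma invariant_generators_subset_polyring:
  assumes "2 \<le> r" "r < n" "p > 0"
  shows "invariant_generators p n r \<subseteq> (polyring n :: 'k::field laurent set)"
proof
  fix x :: "'k laurent" assume "x \<in> invariant_generators p n r"
  then consider i where "2 \<le> i" "i \<le> r" "x = X n * f p n r i" | i where "r < i" "i \<le> n" "x = X i"
    by (auto simp: invariant_generators_def Suc_le_eq)
  then show "x \<in> polyring n"
  proof cases
    case 1
    then show ?thesis
      using assms by (auto simp: X_mult_f intro!: subring_closed X_in_polyring)
  qed (auto intro: X_in_polyring)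
qed

section \<open>Cancelling powers of x_n in the algebra of the claimed invariants\<close>

context
  fixes p n r :: nat and A :: "'k::field laurent set"
  assumes p: "p \<ge> 2" and r: "2 \<le> r" "r < n"
  defines "A \<equiv> kalg (invariant_generators p n r)"
begin

lemma A_subring: "is_subring A"
  by (simp add: A_def)

lemma A_subset_polyring: "A \<subseteq> polyring n"
  unfolding A_def using r p by (intro kalg_subset invariant_generators_subset_polyring) auto

lemma A_generators: "2 \<le> i \<Longrightarrow> i \<le> r \<Longrightarrow> X n * f p n r i \<in> A" "r < i \<Longrightarrow> i \<le> n \<Longrightarrow> X i \<in> A"
  by (auto simp: A_def invariant_generators_def intro!: kalg_generator)

text \<open>The elements that some power of x_n moves into \<open>A\<close> form a subring:
  \<open>A\<close> contains x_n, so sums can be brought to a common power. All the generators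
  qualify with power 0 or 1.\<close>

lemma clear_denominator:
  assumes "c \<in> adjoin (laurent_base n) (f p n r ` {2..n - 1})"
  shows "\<exists>m. X n ^ m * c \<in> A"
proof -
  let ?S = "{c. \<exists>m. X n ^ m * c \<in> A}"
  note A = A_subring
  have z: "X n \<in> A" using r by (intro A_generators) auto
  have "is_subring ?S"
  proof (rule is_subringI)
    show "0 \<in> ?S" "1 \<in> ?S"
      using subring_zero[OF A] subring_one[OF A] by (auto intro!: exI[of _ 0])
    show "- x \<in> ?S" if "x \<in> ?S" for x
      using that subring_uminus[OF A] by fastforce
    fix x y assume "x \<in> ?S" "y \<in> ?S"
    then obtain l m where lm: "X n ^ l * x \<in> A" "X n ^ m * y \<in> A" by auto
    have "X n ^ (l + m) * (x + y) = X n ^ m * (X n ^ l * x) + X n ^ l * (X n ^ m * y)"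
      by (simp add: power_add algebra_simps)
    also have "\<dots> \<in> A" by (intro subring_closed A lm z)
    finally show "x + y \<in> ?S" by blast
    have "X n ^ (l + m) * (x * y) = (X n ^ l * x) * (X n ^ m * y)"
      by (simp add: power_add algebra_simps)
    also have "\<dots> \<in> A" by (intro subring_closed A lm)
    finally show "x * y \<in> ?S" by blast
  qed
  moreover have "laurent_base n \<subseteq> ?S"
    unfolding laurent_base_def
  proof (rule kalg_subset[OF \<open>is_subring ?S\<close>])
    have "const d \<in> ?S" for d
      using const_in_kalg[of d "invariant_generators p n r"] by (auto simp: A_def intro!: exI[of _ 0])
    then show "range const \<subseteq> ?S" by blast
    have "X n ^ 1 * Xinv n \<in> A" using subring_one[OF A] by (simp add: X_mult_Xinv)
    moreover have "X n ^ 0 * X n \<in> A" using z by simp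
    ultimately show "{X n, Xinv n} \<subseteq> ?S" by blast
  qed
  moreover have "f p n r i \<in> ?S" if "2 \<le> i" "i < n" for i
  proof (cases "i \<le> r")
    case True
    with that have "X n ^ 1 * f p n r i \<in> A" by (simp add: A_generators)
    then show ?thesis by blast
  next
    case False
    with that have "X n ^ 0 * f p n r i \<in> A" by (simp add: A_generators f_last)
    then show ?thesis by blast
  qed
  then have "f p n r ` {2..n - 1} \<subseteq> ?S" by auto
  ultimately show ?thesis
    using adjoin_subset[of ?S] assms by blast
qed

lemma divide_in_A:
  assumes "X n * b \<in> A" "b \<in> polyring n"
  shows "b \<in> A"
proof -
  note A = A_subring and L = is_subring_laurent_in and c = const_hom
  \<comment> \<open>The \<open>w j\<close> generate \<open>A\<close> together with \<open>x\<^sub>n\<close>, and modulo \<open>x\<^sub>n\<close> they become the algebraically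
    independent \<open>x\<^sub>j\<^bsup>e j\<^esup>\<close>; hence \<open>A / x\<^sub>n A\<close> embeds into the polynomial ring modulo \<open>x\<^sub>n\<close>.\<close>
  define w :: "nat \<Rightarrow> 'k laurent" where
    "w j = (if j < r then X n * f p n r (Suc j) - X n * f p n r j
      else if j = r then X n * f p n r 2 else X j)" for j
  \<comment> \<open>Modulo x_n, the difference of consecutive x_n f_j leaves x_j^p, and x_n f_2
    leaves x_r^(p*p).\<close>
  define e where "e j = (if j < r then p else if j = r then p * p else 1)" for j
  \<comment> \<open>\<open>\<theta>\<close> lifts polynomials into \<open>A\<close>,
    \<open>\<rho>\<close> is reduction modulo x_n, and \<open>\<mu>\<close> will be their composite.
    Inverses get the dummy value 0, as all arguments have nonnegative exponents.\<close>
  define \<theta> where "\<theta> = (subst const w (\<lambda>_. 0) :: 'k laurent \<Rightarrow> _)"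
  define \<rho> where "\<rho> = (subst const (\<lambda>i. if i = n then 0 else X i) (\<lambda>_. 0) :: 'k laurent \<Rightarrow> 'k laurent)"
  define \<mu> where "\<mu> = (subst const (\<lambda>i. X i ^ e i) (\<lambda>_. 0) :: 'k laurent \<Rightarrow> 'k laurent)"
  let ?B = "kalg (X ` {2..n - 1}) :: 'k laurent set" and ?L = "laurent_in {} :: 'k laurent set"
  have BL: "?B \<subseteq> ?L" by (rule kalg_subset) auto
  have AL: "A \<subseteq> ?L" using A_subset_polyring polyring_subset_laurent_in by blast
  have \<theta>: "is_ring_hom_on ?L \<theta>" and \<rho>: "is_ring_hom_on ?L \<rho>" and \<mu>: "is_ring_hom_on ?L \<mu>"
    unfolding \<theta>_def \<rho>_def \<mu>_def by (rule subst_hom[OF c]; simp)+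
  have \<theta>X: "\<theta> (X i) = w i" and \<rho>X: "\<rho> (X i) = (if i = n then 0 else X i)" and \<mu>X: "\<mu> (X i) = X i ^ e i"
    and \<theta>c: "\<theta> (const d) = const d" and \<rho>c: "\<rho> (const d) = const d" and \<mu>c: "\<mu> (const d) = const d" for i d
    by (simp_all add: \<theta>_def \<rho>_def \<mu>_def subst_X[OF c] subst_const[OF c])
  note \<theta>_simps = hom_add[OF \<theta>] hom_mult[OF \<theta>] hom_sum[OF L \<theta>] hom_uminus[OF L \<theta>]
  note \<rho>_simps = hom_add[OF \<rho>] hom_diff[OF L \<rho>] hom_mult[OF \<rho>] hom_power[OF L \<rho>] hom_sum[OF L \<rho>]

  have wA: "w j \<in> A" if "2 \<le> j" "j < n" for j
    using that r by (auto simp: w_def intro!: subring_closed A A_generators)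
  have \<theta>B: "\<theta> ` ?B \<subseteq> A"
    unfolding kalg_def
  proof (rule hom_image_adjoin[OF L \<theta> A])
    show "\<theta> ` range const \<subseteq> A" by (auto simp: \<theta>c A_def)
    show "\<theta> ` X ` {2..n - 1} \<subseteq> A" using r by (auto simp: \<theta>X intro!: wA)
  qed auto
  have f_\<theta>: "\<exists>q\<in>?B. X n * f p n r i = \<theta> q" if i: "2 \<le> i" "i \<le> r" for i
  proof
    \<comment> \<open>The sum of the \<open>w j\<close> telescopes to x_n f_i - x_n f_2, and
      \<open>w r\<close> restores x_n f_2.\<close>
    let ?q = "X r + (\<Sum>j\<in>{2..<i}. X j)"
    have "\<theta> ?q = w r + (\<Sum>j\<in>{2..<i}. w j)"
      by (simp add: \<theta>_simps \<theta>X subring_sum[OF L])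
    also have "(\<Sum>j\<in>{2..<i}. w j) = (\<Sum>j\<in>{2..<i}. X n * f p n r (Suc j) - X n * f p n r j)"
      using i by (intro sum.cong) (auto simp: w_def)
    also have "\<dots> = X n * f p n r i - X n * f p n r 2"
      using i by (rule_tac sum_Suc_diff')
    finally show "X n * f p n r i = \<theta> ?q" by (simp add: w_def)
    show "?q \<in> ?B" using i r by (intro subring_closed is_subring_kalg kalg_generator) auto
  qed

  \<comment> \<open>Splitting off multiples of x_n: \<open>?D\<close> is a subring containing the
    generators of \<open>A\<close>, so every element of \<open>A\<close> is some
    \<open>\<theta> q\<close> modulo x_n \<open>A\<close>.\<close>
  let ?D = "{a. \<exists>q\<in>?B. \<exists>a'\<in>A. a = \<theta> q + X n * a'}"
  have z: "X n \<in> A" using r by (intro A_generators) auto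
  have D: "is_subring ?D"
  proof (rule is_subringI)
    have "\<theta> q \<in> ?D" if "q \<in> ?B" for q
      using that subring_zero[OF A] by force
    from this[of 0] this[of 1] show "0 \<in> ?D" "1 \<in> ?D"
      by (simp_all add: hom_zero[OF L \<theta>] hom_one[OF \<theta>] subring_zero subring_one)
    fix x assume "x \<in> ?D"
    then obtain q a where q: "q \<in> ?B" "a \<in> A" "x = \<theta> q + X n * a" by auto
    then have "- x = \<theta> (- q) + X n * (- a)" using BL by (simp add: \<theta>_simps subset_iff)
    with q show "- x \<in> ?D" using A by (blast intro: subring_uminus is_subring_kalg)
    fix y assume "y \<in> ?D"
    then obtain s b where s: "s \<in> ?B" "b \<in> A" "y = \<theta> s + X n * b" by auto
    have "x + y = \<theta> (q + s) + X n * (a + b)"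
      using q s BL by (simp add: \<theta>_simps subset_iff algebra_simps)
    with q s show "x + y \<in> ?D" using A by (blast intro: subring_add is_subring_kalg)
    have "x * y = \<theta> (q * s) + X n * (\<theta> q * b + a * (\<theta> s + X n * b))"
      using q s BL by (simp add: \<theta>_simps subset_iff algebra_simps)
    moreover have "\<theta> q * b + a * (\<theta> s + X n * b) \<in> A"
      using q s \<theta>B by (intro subring_closed A z) auto
    ultimately show "x * y \<in> ?D" using q s by (blast intro: subring_mult is_subring_kalg)
  qed
  have "A \<subseteq> ?D"
    unfolding A_def
  proof (rule kalg_subset[OF D[unfolded A_def]]; fold A_def)
    have **: "x \<in> ?D" if "q \<in> ?B" "x = \<theta> q" for x q
      using that subring_zero[OF A] by force
    have "const d \<in> ?D" for d by (rule **[of "const d"]) (simp_all add: \<theta>c)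
    then show "range const \<subseteq> ?D" by blast
    have "X i \<in> ?D" if "r < i" "i \<le> n" for i
    proof (cases "i = n")
      case True
      then have "X i = \<theta> 0 + X n * 1" by (simp add: hom_zero[OF L \<theta>])
      then show ?thesis using subring_one[OF A] subring_zero[OF is_subring_kalg] by blast
    next
      case False
      with that r show ?thesis
        by (intro **[of "X i"]) (auto simp: \<theta>X w_def intro!: kalg_generator)
    qed
    moreover have "X n * f p n r i \<in> ?D" if "2 \<le> i" "i \<le> r" for i
      using f_\<theta>[OF that] ** by blast
    ultimately show "invariant_generators p n r \<subseteq> ?D"
      unfolding invariant_generators_def by auto
  qed
  with assms obtain q a where q: "q \<in> ?B" "a \<in> A" "X n * b = \<theta> q + X n * a" by blast

  have \<rho>f: "\<rho> (X n * f p n r i) = (\<Sum>j\<in>{2..<i}. X j ^ p) + X r ^ (p * p)" if i: "2 \<le> i" "i \<le> r" for i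
  proof -
    have "\<rho> (\<Sum>j\<in>{2..<i}. X j ^ p) = (\<Sum>j\<in>{2..<i}. X j ^ p)"
      using i r by (simp add: \<rho>_simps \<rho>X subring_power)
    then show ?thesis
      using i r p
      by (simp add: X_mult_f \<rho>_simps \<rho>X subring_closed power_mult zero_power)
  qed
  have "\<rho> (\<theta> q) = \<mu> q"
  proof (rule hom_eq_on_adjoin[of ?B "\<lambda>x. \<rho> (\<theta> x)" \<mu> "range const" "X ` {2..n - 1}"])
    show "is_ring_hom_on ?B (\<lambda>x. \<rho> (\<theta> x))"
      using hom_subset[OF \<theta> BL] hom_subset[OF \<rho> AL] \<theta>B by (rule hom_comp)
    show "is_ring_hom_on ?B \<mu>" using \<mu> BL by (rule hom_subset)
    show "q \<in> adjoin (range const) (X ` {2..n - 1})" using q(1) by (simp only: kalg_def)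
    show "\<rho> (\<theta> x) = \<mu> x" if "x \<in> range const" for x
      using that by (auto simp: \<theta>c \<rho>c \<mu>c)
    show "\<rho> (\<theta> x) = \<mu> x" if "x \<in> X ` {2..n - 1}" for x
    proof -
      from that r obtain j where j: "2 \<le> j" "j < n" "x = X j" by auto
      consider "j < r" | "j = r" | "r < j" by linarith
      then have "\<rho> (w j) = X j ^ e j"
      proof cases
        case 1
        have "\<rho> (w j) = \<rho> (X n * f p n r (Suc j)) - \<rho> (X n * f p n r j)"
          using 1 j AL A_generators(1) by (simp add: w_def hom_diff[OF L \<rho>] subset_iff)
        then show ?thesis using 1 j by (simp add: \<rho>f e_def)
      qed (use r j in \<open>simp_all add: w_def e_def \<rho>f \<rho>X\<close>)
      then show ?thesis using j by (simp add: \<theta>X \<mu>X)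
    qed
  qed (auto simp: kalg_generator)
  \<comment> \<open>Reduction kills x_n b - x_n a, so \<open>\<mu> q = 0\<close>. Injectivity of
    \<open>\<mu>\<close> forces q = 0, and then b = a lies in \<open>A\<close>.\<close>
  moreover have "\<rho> (\<theta> q) = \<rho> (X n * b - X n * a)" using q(3) by simp
  moreover have "b \<in> ?L" "a \<in> ?L"
    using q(2) AL assms(2) polyring_subset_laurent_in by auto
  ultimately have "\<mu> q = 0" by (simp add: \<rho>_simps \<rho>X subring_mult)
  then have "q = 0"
    unfolding \<mu>_def using q(1) BL p by (intro subst_powers_eq_0[of q e]) (auto simp: e_def)
  with q(3) have "X n * b = X n * a" by (simp add: hom_zero[OF L \<theta>])
  then have "Xinv n * (X n * b) = Xinv n * (X n * a)" by simp
  with q(2) show ?thesis by (simp add: Xinv_mult_X flip: mult.assoc)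
qed

lemma divide_power_in_A: "X n ^ m * b \<in> A \<Longrightarrow> b \<in> polyring n \<Longrightarrow> b \<in> A"
proof (induction m)
  case (Suc m)
  then have "X n ^ m * b \<in> polyring n"
    using r by (intro subring_closed X_in_polyring) auto
  with Suc show ?case
    using divide_in_A[of "X n ^ m * b"] by (simp add: mult.assoc)
qed simp

end

section \<open>Determination of the invariant ring\<close>

lemma invariants_polyring:
  fixes E :: "'k::field laurent \<Rightarrow> 'k laurent poly"
  assumes p: "CHAR('k) = p" "p > 0" and r: "2 \<le> r" "r < n" and tilde: "is_E_tilde p n r E"
  shows "invariants (polyring n) E = kalg (invariant_generators p n r)"
proof
  note E = is_E_tilde_hom[OF tilde] and L = is_subring_laurent_ring
  have p2: "p \<ge> 2" using p_ge_2[OF p r tilde] .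
  have f1: "E (f p n r 1) = [:f p n r 1, 1:]" using is_E_tilde_f1[OF tilde] .
  show "kalg (invariant_generators p n r) \<subseteq> invariants (polyring n) E"
  proof (rule kalg_subset)
    show "is_subring (invariants (polyring n) E)"
      using E_hom_polyring[OF p r tilde] by (simp add: is_subring_invariants)
    show "range const \<subseteq> invariants (polyring n) E"
      by (auto simp: invariants_def E_const[OF p r tilde])
    have "E x = [:x:]" if "x \<in> invariant_generators p n r" for x
      using that unfolding invariant_generators_def
    proof (elim UnE imageE)
      fix i assume "x = X n * f p n r i" "i \<in> {2..r}"
      then show ?thesis
        using r by (simp add: hom_mult[OF E] X_in_laurent_ring f_in_laurent_ring E_Xn[OF p r tilde]
            is_E_tilde_f[OF tilde])
    qed (use r E_X_last[OF p r tilde] in auto)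
    then show "invariant_generators p n r \<subseteq> invariants (polyring n) E"
      using invariant_generators_subset_polyring[OF r p(2)] by (auto simp: invariants_def)
  qed
  show "invariants (polyring n) E \<subseteq> kalg (invariant_generators p n r)"
  proof
    fix b assume "b \<in> invariants (polyring n) E"
    then have b: "b \<in> polyring n" "E b = [:b:]" by (auto simp: invariants_def)
    let ?C = "adjoin (laurent_base n) (f p n r ` {2..n - 1}) :: 'k laurent set"
    \<comment> \<open>The slice \<open>f 1\<close>: evaluating at \<open>T = - f 1\<close> is a projection onto the invariants.\<close>
    define \<pi> where "\<pi> x = poly (E x) (- f p n r 1)" for x
    have "is_ring_hom_on (laurent_ring n) \<pi>"
      unfolding \<pi>_def using E poly_hom by (rule hom_comp) simp
    \<comment> \<open>\<open>\<pi>\<close> sends f_1 to f_1 - f_1 = 0 and fixes the other f_i, so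
      f_1 drops out of the generators of the image.\<close>
    moreover have "\<pi> ` (f p n r ` {1..n - 1}) \<subseteq> ?C"
    proof clarify
      fix i assume i: "i \<in> {1..n - 1}"
      show "\<pi> (f p n r i) \<in> ?C"
      proof (cases "i = 1")
        case True
        then show ?thesis
          using f1 by (simp add: \<pi>_def subring_zero)
      next
        case False
        with i have "f p n r i \<in> ?C" "E (f p n r i) = [:f p n r i:]"
          by (auto intro!: adjoin_generator is_E_tilde_f[OF tilde])
        then show ?thesis by (simp add: \<pi>_def)
      qed
    qed
    moreover have "\<pi> ` laurent_base n \<subseteq> ?C"
      by (auto simp: \<pi>_def is_E_tilde_base[OF tilde] adjoin_base)
    moreover have "f p n r ` {1..n - 1} \<subseteq> laurent_ring n"
      using r by (auto intro!: f_in_laurent_ring)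
    ultimately have "\<pi> ` laurent_ring n \<subseteq> ?C"
      using hom_image_adjoin[OF L, of n \<pi> ?C "laurent_base n" "f p n r ` {1..n - 1}"] laurent_base_subset[of n]
      by (simp add: adjoin_f_eq_laurent_ring[OF r] del: One_nat_def)
    then have "\<pi> b \<in> ?C" using b(1) polyring_subset_laurent_ring by auto
    then have "b \<in> ?C" using b(2) by (simp add: \<pi>_def)
    from clear_denominator[OF p2 r this] b(1) divide_power_in_A[OF p2 r]
    show "b \<in> kalg (invariant_generators p n r)" by blast
  qed
qed

section \<open>The rank\<close>

text \<open>Scaling every \<open>x\<^sub>i\<close> by \<open>T\<close> makes \<open>coeff (jet P) 1\<close> the linear part of \<open>P\<close>.\<close>

definition jet :: "'k::field laurent \<Rightarrow> 'k laurent poly" where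
  "jet = subst (\<lambda>c. [:const c:]) (\<lambda>i. [:0, X i:]) (\<lambda>_. 0)"

lemma jet_hom: "is_ring_hom_on (polyring n) jet"
  unfolding jet_def
  by (rule hom_subset[OF subst_hom[OF const_pCons_hom, of "{}"] polyring_subset_laurent_in]) simp

lemma jet_const: "jet (const c) = [:const c:]"
  and jet_X: "jet (X i) = [:0, X i:]"
  by (simp_all add: jet_def subst_const[OF const_pCons_hom] subst_X[OF const_pCons_hom])

text \<open>Taking the constant term is multiplicative and kills the variables. Having it in k makes
  the linear part of a product a k-combination of linear parts.\<close>

lemma coeff_jet_0:
  assumes "P \<in> polyring n"
  shows "coeff (jet P) 0 \<in> range const"
proof -
  have C: "is_subring (range const :: 'a laurent set)"
    using is_subring_image[OF _ const_hom] by (simp add: is_subring_def)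
  have "is_ring_hom_on UNIV (\<lambda>q :: 'a laurent poly. coeff q 0)"
    by (simp add: is_ring_hom_on_def coeff_mult)
  then have "is_ring_hom_on (polyring n) (\<lambda>P :: 'a laurent. coeff (jet P) 0)"
    using jet_hom by (rule_tac hom_comp) auto
  then have "(\<lambda>P. coeff (jet P) 0) ` adjoin (range const) (X ` {1..n}) \<subseteq> (range const :: 'a laurent set)"
    using C by (intro hom_image_adjoin[of "polyring n"])
      (auto simp: X_in_polyring jet_const jet_X intro!: image_eqI[of 0 const 0])
  then show ?thesis using assms unfolding polyring_def kalg_def by blast
qed

lemma laurent_vector_space: "vector_space (\<lambda>c P. const c * (P :: 'k::field laurent))"
  by unfold_locales (simp_all add: const_add const_mult algebra_simps)

text \<open>By the product rule, the linear part of P Q is P(0) times that of Q plus Q(0) times that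
  of P, so the condition defines a subring. The map \<open>G\<close> allows the use for a subalgebra
  (\<open>G\<close> the identity) and for images under an automorphism.\<close>

lemma linear_part_in_span:
  fixes G :: "'k::field laurent \<Rightarrow> 'k laurent"
  assumes G: "is_ring_hom_on (kalg T) G" and GB: "G ` kalg T \<subseteq> polyring n"
    and Gc: "\<And>c. G (const c) = const c"
    and GT: "\<And>t. t \<in> T \<Longrightarrow> coeff (jet (G t)) 1 \<in> module.span (\<lambda>c P. const c * P) S"
    and P: "P \<in> kalg T"
  shows "coeff (jet (G P)) 1 \<in> module.span (\<lambda>c P. const c * P) S"
proof -
  interpret V: vector_space "\<lambda>c P. const c * (P :: 'k laurent)"
    by (rule laurent_vector_space)
  let ?D = "{P \<in> kalg T. coeff (jet (G P)) 1 \<in> V.span S}"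
  have B: "is_subring (kalg T)" by simp
  have J: "is_ring_hom_on (kalg T) (\<lambda>P. jet (G P))"
    using G jet_hom GB by (rule hom_comp)
  have "is_subring ?D"
  proof (rule is_subringI)
    show "0 \<in> ?D" "1 \<in> ?D"
      using subring_zero[OF B] subring_one[OF B]
      by (simp_all add: hom_zero[OF B J] hom_one[OF J] V.span_zero)
    fix x assume x: "x \<in> ?D"
    then show "- x \<in> ?D"
      using V.span_neg by (auto simp: hom_uminus[OF B J] subring_uminus)
    fix y assume y: "y \<in> ?D"
    show "x + y \<in> ?D"
      using x y V.span_add by (auto simp: hom_add[OF J] subring_add)
    obtain c d where "coeff (jet (G x)) 0 = const c" "coeff (jet (G y)) 0 = const d"
      using coeff_jet_0[of "G x" n] coeff_jet_0[of "G y" n] x y GB by blast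
    then have "coeff (jet (G (x * y))) 1 =
        const c * coeff (jet (G y)) 1 + const d * coeff (jet (G x)) 1"
      using x y by (simp add: hom_mult[OF J] coeff_mult mult.commute)
    also have "\<dots> \<in> V.span S"
      using x y by (intro V.span_add V.span_scale) auto
    finally show "x * y \<in> ?D" using x y by (simp add: subring_mult)
  qed
  moreover have "range const \<subseteq> ?D"
    by (auto simp: Gc jet_const coeff_pCons V.span_zero)
  moreover have "T \<subseteq> ?D" using GT by (auto simp: kalg_generator)
  ultimately show ?thesis using kalg_subset[of ?D T] P by blast
qed

text \<open>Every term of x_n f_i has order at least 2 at the origin, because p \<ge> 2.\<close>

lemma linear_part_X_mult_f:
  assumes "2 \<le> i" "i \<le> r" "r < n" "p \<ge> 2"
  shows "coeff (jet (X n * f p n r i :: 'k::field laurent)) 1 = 0"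
proof -
  let ?J = "jet :: 'k laurent \<Rightarrow> _"
  note J = jet_hom[of n] and B = is_subring_polyring
  have X: "X j \<in> (polyring n :: 'k laurent set)" if "1 \<le> j" "j \<le> n" for j
    using that by (rule X_in_polyring)
  have monom: "[:0, a:] = monom a 1" for a :: "'k laurent"
    by (simp add: monom_altdef)
  have pow: "[:0, a:] ^ k = monom (a ^ k) k" for a :: "'k laurent" and k
    by (simp add: monom monom_power)
  have s: "?J (\<Sum>j\<in>{2..<i}. X j ^ p) = (\<Sum>j\<in>{2..<i}. monom (X j ^ p) p)"
    using assms by (subst hom_sum[OF B J]) (auto simp: hom_power[OF B J] X jet_X pow intro!: subring_closed X sum.cong)
  have S: "(\<Sum>j\<in>{2..<i}. X j ^ p) \<in> (polyring n :: 'k laurent set)"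
    using assms by (auto intro!: subring_closed X)
  let ?u = "monom (X n * X 1) 2 + monom (X r ^ p) p :: 'k laurent poly"
  have "?J (X n * f p n r i) = monom (X n * X i) 2 + (\<Sum>j\<in>{2..<i}. monom (X j ^ p) p)
      + ?u ^ p - monom (X n ^ (p - 1)) (p - 1) * ?u"
  proof -
    have "monom a 1 * monom b 1 = monom (a * b) 2" for a b :: "'k laurent"
      by (simp add: mult_monom numeral_2_eq_2)
    then have two: "?J (X a * X b) = monom (X a * X b) 2" if "1 \<le> a" "a \<le> n" "1 \<le> b" "b \<le> n" for a b
      by (simp only: hom_mult[OF J X X] jet_X monom that)
    have "?J (X n * X 1 + X r ^ p) = ?J (X n * X 1) + ?J (X r) ^ p"
      using assms by (simp add: hom_add[OF J] hom_power[OF B J] X subring_closed)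
    also have "\<dots> = ?u" using assms by (simp add: two jet_X pow del: One_nat_def)
    finally have "?J (X n * X 1 + X r ^ p) = ?u" .
    moreover have "?J (X n * X i) = monom (X n * X i) 2"
      using assms by (simp add: two)
    moreover have "p > 0" using assms by simp
    ultimately show ?thesis
      using assms S s
      by (subst X_mult_f) (simp_all add: hom_add[OF J] hom_diff[OF B J] hom_mult[OF J, of "X n ^ _"]
        hom_power[OF B J] X subring_closed jet_X pow del: One_nat_def)
  qed
  moreover have "coeff (?u ^ p) 1 = 0"
  proof -
    \<comment> \<open>A product with two factors free of constant term has no linear term, and p
      \<ge> 2 provides two such factors.\<close>
    have "coeff ?u 0 = 0" using assms by simp
    then have "coeff (?u * ?u * v) 1 = 0" for v
      by (simp add: coeff_mult)
    moreover have "?u ^ p = ?u * ?u * ?u ^ (p - 2)"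
    proof -
      obtain q where "p = Suc (Suc q)" using assms(4) by (metis add_2_eq_Suc le_Suc_ex)
      then show ?thesis by (simp only: power_Suc mult.assoc) simp
    qed
    ultimately show ?thesis by (simp only:)
  qed
  moreover have "coeff (monom (X n ^ (p - 1)) (p - 1) * ?u) 1 = 0"
    using assms by (simp add: coeff_mult)
  ultimately show ?thesis
    using assms by (simp add: coeff_sum)
qed

section \<open>Linear independence of the variables and the value of gamma\<close>

lemma inj_X: "inj (X :: nat \<Rightarrow> 'k::field laurent)"
proof (rule injI)
  fix i j assume "X i = (X j :: 'k laurent)"
  then have "Poly_Mapping.lookup (X i :: 'k laurent) (Poly_Mapping.single i 1)
      = Poly_Mapping.lookup (X j :: 'k laurent) (Poly_Mapping.single i 1)" by simp
  then have "Poly_Mapping.single j 1 = (Poly_Mapping.single i 1 :: nat \<Rightarrow>\<^sub>0 int)"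
    by (simp add: X_def lookup_single when_def split: if_splits)
  then have "Poly_Mapping.lookup (Poly_Mapping.single j 1 :: nat \<Rightarrow>\<^sub>0 int) i
      = Poly_Mapping.lookup (Poly_Mapping.single i 1) i" by simp
  then show "i = j" by (simp add: lookup_single when_def split: if_splits)
qed

lemma const_mult_X: "const c * X i = Poly_Mapping.single (Poly_Mapping.single i 1) c"
  by (simp add: const_def X_def mult_single)

lemma independent_X:
  assumes "finite I"
  shows "\<not> module.dependent (\<lambda>c P. const c * P) (X ` I :: 'k::field laurent set)"
proof -
  interpret V: vector_space "\<lambda>c P. const c * (P :: 'k laurent)"
    by (rule laurent_vector_space)
  show ?thesis
  proof (rule V.independent_if_scalars_zero)
    show "finite (X ` I :: 'k laurent set)" using assms by simp
    fix g :: "'k laurent \<Rightarrow> 'k" and x :: "'k laurent"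
    assume 0: "(\<Sum>x\<in>X ` I. const (g x) * x) = 0" and "x \<in> X ` I"
    then obtain i where i: "i \<in> I" "x = X i" by auto
    have eq: "Poly_Mapping.single j 1 = (Poly_Mapping.single i 1 :: nat \<Rightarrow>\<^sub>0 int) \<longleftrightarrow> j = i" for j
      using injD[OF inj_X[where 'k = 'k], of j i] by (auto simp: X_def)
    have "(\<Sum>x\<in>X ` I. const (g x) * x) = (\<Sum>j\<in>I. const (g (X j)) * X j)"
      by (rule sum.reindex[THEN trans]) (simp_all add: inj_on_subset[OF inj_X])
    then have "Poly_Mapping.lookup (\<Sum>x\<in>X ` I. const (g x) * x) (Poly_Mapping.single i 1) =
        (\<Sum>j\<in>I. if j = i then g (X j) else 0)"
      by (simp add: const_mult_X lookup_sum lookup_single when_def eq)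
    then show "g x = 0" using 0 i assms by simp
  qed
qed

text \<open>A dimension count: x_1, ..., x_n lie in the span of x_(r+1), ..., x_n and the linear
  parts of the last n - N images under \<phi>, so n \<le> (n - r) + (n - N).\<close>

lemma gamma_upper_bound:
  fixes \<phi> :: "'k::field laurent \<Rightarrow> 'k laurent"
  assumes p: "p \<ge> 2" and r: "2 \<le> r" "r < n" and \<phi>: "\<phi> \<in> kaut n"
    and N: "N \<le> n" "\<phi> ` polyring N \<subseteq> kalg (invariant_generators p n r)"
  shows "N \<le> n - r"
proof -
  interpret V: vector_space "\<lambda>c P. const c * (P :: 'k laurent)"
    by (rule laurent_vector_space)
  define g where "g i = coeff (jet (\<phi> (X i))) 1" for i
  let ?T = "X ` {r + 1..n} \<union> g ` {N + 1..n}"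
  have A: "kalg (invariant_generators p n r) \<subseteq> (polyring n :: 'k laurent set)"
    using r p by (intro kalg_subset invariant_generators_subset_polyring) auto
  have linA: "coeff (jet a) 1 \<in> V.span ?T" if "a \<in> kalg (invariant_generators p n r)" for a
  proof (rule linear_part_in_span[OF hom_id _ _ _ that])
    show "(\<lambda>x. x) ` kalg (invariant_generators p n r) \<subseteq> (polyring n :: 'k laurent set)" using A by simp
    fix t :: "'k laurent" assume "t \<in> invariant_generators p n r"
    then show "coeff (jet t) 1 \<in> V.span ?T"
      unfolding invariant_generators_def
    proof (elim UnE imageE)
      fix i assume "t = X n * f p n r i" "i \<in> {2..r}"
      then show ?thesis
        using r p by (simp add: linear_part_X_mult_f V.span_zero del: One_nat_def)
    next
      fix i assume "t = X i" "i \<in> {r + 1..n}"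
      then show ?thesis by (intro V.span_base) (simp add: jet_X)
    qed
  qed simp
  \<comment> \<open>The first N images lie in the subalgebra, so their linear parts come from
    x_(r+1), ..., x_n; the others are in \<open>?T\<close> by construction.\<close>
  have g: "g i \<in> V.span ?T" if "1 \<le> i" "i \<le> n" for i
  proof (cases "i \<le> N")
    case True
    with that have "X i \<in> (polyring N :: 'k laurent set)" by (simp add: X_in_polyring)
    with N(2) have "\<phi> (X i) \<in> kalg (invariant_generators p n r)" by blast
    from linA[OF this] show ?thesis unfolding g_def .
  next
    case False
    with that show ?thesis by (intro V.span_base) auto
  qed
  have \<phi>_hom: "is_ring_hom_on (kalg (X ` {1..n})) \<phi>" and \<phi>_img: "\<phi> ` kalg (X ` {1..n}) = polyring n"
    and \<phi>_const: "\<And>c. \<phi> (const c) = const c"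
    using \<phi> by (auto simp: kaut_def polyring_def bij_betw_def)
  have "X ` {1..n} \<subseteq> V.span ?T"
  proof clarify
    fix j assume "j \<in> {1..n}"
    then have "X j \<in> (polyring n :: 'k laurent set)" by (simp add: X_in_polyring)
    \<comment> \<open>Surjectivity of \<phi> enters here: it puts x_j itself into the span of the
      linear parts of the images of the variables.\<close>
    then obtain h where h: "h \<in> kalg (X ` {1..n})" "X j = \<phi> h" using \<phi>_img by blast
    have "coeff (jet (\<phi> h)) 1 \<in> V.span ?T"
      by (rule linear_part_in_span[OF \<phi>_hom _ \<phi>_const _ h(1)]) (use \<phi>_img g in \<open>auto simp: g_def\<close>)
    then show "X j \<in> V.span ?T" by (simp add: jet_X flip: h(2))
  qed
  then have "card (X ` {1..n} :: 'k laurent set) \<le> card ?T"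
    using V.independent_span_bound[OF _ independent_X, of ?T "{1..n}"] by simp
  also have "\<dots> \<le> card (X ` {r + 1..n} :: 'k laurent set) + card (g ` {N + 1..n})"
    by (rule card_Un_le)
  also have "\<dots> \<le> (n - r) + (n - N)"
    using card_image_le[of "{r + 1..n}" "X :: nat \<Rightarrow> 'k laurent"] card_image_le[of "{N + 1..n}" g]
    by simp
  also have "card (X ` {1..n} :: 'k laurent set) = n"
    by (simp add: card_image inj_on_subset[OF inj_X])
  finally show ?thesis using N(1) r by linarith
qed

text \<open>\<open>gamma\<close> refers to the first N variables, whereas the invariants contain the
  last n - r. The reversal i -> n + 1 - i exchanges the two ends, and it is bijective as an
  involution.\<close>

lemma reverse_variables_kaut:
  "subst const (\<lambda>i. X (n + 1 - i)) (\<lambda>_. 0) \<in> (kaut n :: ('k::field laurent \<Rightarrow> _) set)" 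
proof -
  define \<phi> where "\<phi> = (subst const (\<lambda>i. X (n + 1 - i)) (\<lambda>_. 0) :: 'k laurent \<Rightarrow> 'k laurent)"
  note B = is_subring_polyring
  have hom: "is_ring_hom_on (polyring n) \<phi>"
    unfolding \<phi>_def
    by (rule hom_subset[OF subst_hom[OF const_hom, of "{}"] polyring_subset_laurent_in]) simp
  have simps: "\<phi> (const c) = const c" "\<phi> (X i) = X (n + 1 - i)" for c i
    by (simp_all add: \<phi>_def subst_const[OF const_hom] subst_X[OF const_hom])
  have "\<phi> ` adjoin (range const) (X ` {1..n}) \<subseteq> polyring n"
    by (rule hom_image_adjoin[OF B hom B]) (auto simp: simps X_in_polyring)
  then have img: "\<phi> ` polyring n \<subseteq> polyring n"
    by (simp only: polyring_def kalg_def)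
  have "\<phi> (\<phi> x) = x" if "x \<in> polyring n" for x
    by (rule hom_eq_on_adjoin[OF B hom_comp[OF hom hom img] hom_id _ _ _ _
          that[unfolded polyring_def kalg_def]])
       (auto simp: simps X_in_polyring)
  then have "bij_betw \<phi> (polyring n) (polyring n)"
    using img by (intro bij_betwI[of _ _ _ \<phi>]) auto
  then have "\<phi> \<in> kaut n" using hom by (simp add: kaut_def simps)
  then show ?thesis by (simp only: \<phi>_def)
qed

lemma gamma_invariants:
  assumes p: "p \<ge> 2" and r: "2 \<le> r" "r < n"
  shows "gamma n (kalg (invariant_generators p n r) :: 'k::field laurent set) = n - r"
  unfolding gamma_def
proof (rule Max_eqI)
  let ?A = "kalg (invariant_generators p n r) :: 'k laurent set"
  show "finite {N. N \<le> n \<and> (\<exists>\<phi>\<in>kaut n. \<phi> ` polyring N \<subseteq> ?A)}"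
    by (rule finite_subset[of _ "{..n}"]) auto
  show "N \<le> n - r" if "N \<in> {N. N \<le> n \<and> (\<exists>\<phi>\<in>kaut n. \<phi> ` polyring N \<subseteq> ?A)}" for N
    using that gamma_upper_bound[OF p r] by blast
  let ?\<phi> = "subst const (\<lambda>i. X (n + 1 - i)) (\<lambda>_. 0) :: 'k laurent \<Rightarrow> 'k laurent"
  have "?\<phi> ` adjoin (range const) (X ` {1..n - r}) \<subseteq> ?A"
    using is_subring_laurent_in subst_hom[OF const_hom, of "{}"]
  proof (rule hom_image_adjoin)
    show "?\<phi> ` X ` {1..n - r} \<subseteq> ?A"
    proof clarify
      fix i assume "i \<in> {1..n - r}"
      then have "n + 1 - i \<in> {r + 1..n}" using r by auto
      then show "?\<phi> (X i) \<in> ?A"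
        unfolding subst_X[OF const_hom] invariant_generators_def by (intro kalg_generator UnI2 imageI)
    qed
  qed (auto simp: subst_const[OF const_hom])
  then have "?\<phi> ` polyring (n - r) \<subseteq> ?A" by (simp only: polyring_def kalg_def)
  then show "n - r \<in> {N. N \<le> n \<and> (\<exists>\<phi>\<in>kaut n. \<phi> ` polyring N \<subseteq> ?A)}"
    using reverse_variables_kaut by auto
qed

text \<open>\<open>is_E_tilde\<close> determines a map only on \<open>laurent_ring n\<close>.
  Existence and uniqueness there are therefore stated separately, and the remaining claims are made
  for every such \<open>E\<close>.\<close>

theorem proposition6p1:
  fixes p n r :: nat and \<epsilon> :: "'k::field laurent \<Rightarrow> 'k laurent"
  assumes "CHAR('k) = p" and "p > 0"
    and "2 \<le> r" and "r < n"
    and "\<epsilon> \<in> kaut n" and "\<epsilon> (X 1) = X 1 + 1" and "\<forall>i\<in>{2..n}. \<epsilon> (X i) = X i"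
  shows "adjoin (laurent_base n) (f p n r ` {1..n - 1}) = (laurent_ring n :: 'k laurent set)
    \<and> (\<exists>E :: 'k laurent \<Rightarrow> 'k laurent poly. is_E_tilde p n r E)
    \<and> (\<forall>(E :: 'k laurent \<Rightarrow> 'k laurent poly) E'.
          is_E_tilde p n r E \<longrightarrow> is_E_tilde p n r E' \<longrightarrow> (\<forall>b\<in>laurent_ring n. E b = E' b))
    \<and> (\<forall>E :: 'k laurent \<Rightarrow> 'k laurent poly. is_E_tilde p n r E \<longrightarrow>
          (restricts_to E (polyring n) \<and> Ga_action (polyring n) E
             \<and> (\<forall>b\<in>polyring n. action_at E 1 b = \<epsilon> b))
        \<and> (invariants (polyring n) E
             = kalg ((\<lambda>i. X n * f p n r i) ` {2..r} \<union> X ` {r + 1..n})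
           \<and> Ga_rank n E = r))"
proof (intro conjI allI impI ballI)
  note p = assms(1,2) and r = assms(3,4)
  show "adjoin (laurent_base n) (f p n r ` {1..n - 1}) = (laurent_ring n :: 'k laurent set)"
    using r by (rule adjoin_f_eq_laurent_ring)
  show "\<exists>E :: 'k laurent \<Rightarrow> 'k laurent poly. is_E_tilde p n r E"
    using is_E_tilde_E_std[OF r] by blast
  fix E :: "'k laurent \<Rightarrow> 'k laurent poly" assume E: "is_E_tilde p n r E"
  show "E b = E' b" if "is_E_tilde p n r E'" "b \<in> laurent_ring n" for E' b
    using r E that by (rule is_E_tilde_unique)
  show "restricts_to E (polyring n)" using p r E by (rule E_restricts_polyring)
  show "Ga_action (polyring n) E" using p r E by (rule E_Ga_action_polyring)
  show "action_at E 1 b = \<epsilon> b" if "b \<in> polyring n" for b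
    using p r E assms(5-) that by (rule action_at_1_eq)
  note inv = invariants_polyring[OF p r E]
  show "invariants (polyring n) E = kalg ((\<lambda>i. X n * f p n r i) ` {2..r} \<union> X ` {r + 1..n})"
    using inv by (simp only: invariant_generators_def)
  show "Ga_rank n E = r"
    using r by (simp add: Ga_rank_def inv gamma_invariants[OF p_ge_2[OF p r E] r])
qed

end
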